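(* Let $N\geq 1$, $0<s<1$, $0<\sigma<\frac{2s}{N}$ and $c>0$. Suppose that for every initial datum $\psi_0\in\widetilde{\Sigma}_s(\mathbb{R}^N)$ the Cauchy problem $$i\psi_t=(-\Delta)^s\psi+|x|^2\psi-|\psi|^{2\sigma}\psi\ \text{ in }\mathbb{R}^N\times[0,\infty),\qquad \psi(0,\cdot)=\psi_0,$$ has a unique solution $\psi$ with $\psi(t,\cdot)\in\widetilde{\Sigma}_s(\mathbb{R}^N)$ for all $t\ge 0$, and that this solution conserves mass and energy: $\|\psi(t,\cdot)\|_{L^2(\mathbb{R}^N)}=\|\psi_0\|_{L^2(\mathbb{R}^N)}$ and $E(\psi(t,\cdot))=E(\psi_0)$ for all $t\geq 0$. Then the ground state solutions of mass constraint $c$ are orbitally stable, i.e. the set $\widetilde{\mathcal{O}}_c$ is stable.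
   Context: Fractional Laplacian: $(-\Delta)^s u=\mathcal{F}^{-1}[|\xi|^{2s}\mathcal{F}[u]]$. Real-valued spaces: $H_s(\mathbb{R}^N)=\{u\in L^2(\mathbb{R}^N): \int\int\frac{|u(x)-u(y)|^2}{|x-y|^{N+2s}}\,dy\,dx<\infty\}$; $\|\nabla_s u\|_{L^2(\mathbb{R}^N)}^2=C_{N,s}\int_{\mathbb{R}^N}\int_{\mathbb{R}^N}\frac{|u(x)-u(y)|^2}{|x-y|^{N+2s}}\,dx\,dy$, where $C_{N,s}>0$ is the normalization constant for which this equals $\int_{\mathbb{R}^N} u\,(-\Delta)^s u\,dx$; $\Sigma_s(\mathbb{R}^N)=\{u\in H_s(\mathbb{R}^N):\|u\|_{\Sigma_s(\mathbb{R}^N)}:=\|u\|_{L^2}+\|\nabla_s u\|_{L^2}+\|xu\|_{L^2}<\infty\}$. Complex-valued space: $\widetilde{\Sigma}_s(\mathbb{R}^N)=\{\omega=u+iv: (u,v)\in\Sigma_s(\mathbb{R}^N)\times\Sigma_s(\mathbb{R}^N)\}$ with norm $\|\omega\|^2_{\widetilde{\Sigma}_s(\mathbb{R}^N)}=\|u\|^2_{\Sigma_s(\mathbb{R}^N)}+\|v\|^2_{\Sigma_s(\mathbb{R}^N)}$, and $\|\nabla_s\omega\|_{L^2}^2=\|\nabla_s u\|_{L^2}^2+\|\nabla_s v\|_{L^2}^2$. Energy: $E(\psi)=\int_{\mathbb{R}^N}\left[\mathrm{Re}(\psi^*(-\Delta)^s\psi)+|x|^2|\psi|^2-\frac{1}{\sigma+1}|\psi|^{2\sigma+2}\right]dx$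 ($\psi^*$ the complex conjugate; the first term is understood as the quadratic form $\|\nabla_s\psi\|_{L^2}^2$). Thus $E=2\widetilde{\mathcal{J}}$, where $$\widetilde{\mathcal{J}}(\omega)=\frac12\|\nabla_s\omega\|_{L^2}^2+\frac12\int_{\mathbb{R}^N}|x|^2|\omega|^2dx-\frac{1}{2\sigma+2}\int_{\mathbb{R}^N}|\omega|^{2\sigma+2}dx.$$ Let $\widetilde{\mathcal{S}}_c=\{\omega\in\widetilde{\Sigma}_s(\mathbb{R}^N):\int_{\mathbb{R}^N}|\omega|^2dx=c^2\}$, $\widetilde{\mathcal{I}}_c=\inf\{\widetilde{\mathcal{J}}(\omega):\omega\in\widetilde{\mathcal{S}}_c\}$, and let the set of ground states be $\widetilde{\mathcal{O}}_c=\{\omega\in\widetilde{\mathcal{S}}_c:\widetilde{\mathcal{J}}(\omega)=\widetilde{\mathcal{I}}_c\}$. Definition: $\widetilde{\mathcal{O}}_c$ is stable if (1) $\widetilde{\mathcal{O}}_c\neq\emptyset$, and (2) for all $\omega_0\in\widetilde{\mathcal{O}}_c$ and $\varepsilon>0$ there exists $\delta>0$ such that for all $\psi_0\in\widetilde{\Sigma}_s(\mathbb{R}^N)$ with $\|\omega_0-\psi_0\|_{\widetilde{\Sigma}_s(\mathbb{R}^N)}<\delta$ one has $\inf_{\omega\in\widetilde{\mathcal{O}}_c}\|\omega-\psi(t,\cdot)\|_{\widetilde{\Sigma}_s(\mathbb{R}^N)}<\varepsilon$ for all $t\ge0$, where $\psi$ is the solution of the Cauchy problem with initial datum $\psi_0$.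 The ground state solutions in $\widetilde{\mathcal{O}}_c$ are called orbitally stable if $\widetilde{\mathcal{O}}_c$ is stable. *)

theory Defs
  imports "HOL-Analysis.Analysis"
begin

text \<open>
  \<open>\<real>\<^sup>N\<close> is \<^typ>\<open>real ^ 'n\<close> with \<open>N = CARD('n)\<close>. Elements of the function spaces are Borel
  representatives of the usual classes modulo equality almost everywhere; none of the
  quantities below depends on the representative.
\<close>

section \<open>Fractional Laplacian on test functions\<close>

primrec C_k :: "nat \<Rightarrow> (real ^ 'n \<Rightarrow> 'b::real_normed_vector) \<Rightarrow> bool" where
  "C_k 0 f \<longleftrightarrow> continuous_on UNIV f"
| "C_k (Suc k) f \<longleftrightarrow> (\<forall>x. f differentiable (at x)) \<and>
     (\<forall>b\<in>Basis. C_k k (\<lambda>x. frechet_derivative f (at x) b))"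

definition test_function :: "(real ^ 'n \<Rightarrow> 'b::real_normed_vector) \<Rightarrow> bool" where
  "test_function f \<longleftrightarrow> (\<forall>k. C_k k f) \<and> compact (closure {x. f x \<noteq> 0})"

definition fourier :: "(real ^ 'n \<Rightarrow> complex) \<Rightarrow> real ^ 'n \<Rightarrow> complex" where
  "fourier u \<xi> = (2 * pi) powr (- real CARD('n) / 2) *\<^sub>R (LINT x|lborel. cis (- (x \<bullet> \<xi>)) * u x)"

definition inv_fourier :: "(real ^ 'n \<Rightarrow> complex) \<Rightarrow> real ^ 'n \<Rightarrow> complex" where
  "inv_fourier g x = (2 * pi) powr (- real CARD('n) / 2) *\<^sub>R (LINT \<xi>|lborel. cis (x \<bullet> \<xi>) * g \<xi>)"

text \<open>Used only for test functions, where both Fourier integrals converge absolutely.\<close>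

definition frac_laplacian :: "real \<Rightarrow> (real ^ 'n \<Rightarrow> complex) \<Rightarrow> real ^ 'n \<Rightarrow> complex" where
  "frac_laplacian s u = inv_fourier (\<lambda>\<xi>. complex_of_real (norm \<xi> powr (2 * s)) * fourier u \<xi>)"

section \<open>Function spaces\<close>

definition L2_space :: "(real ^ 'n \<Rightarrow> real) set" where
  "L2_space = {u. u \<in> borel_measurable lborel \<and> integrable lborel (\<lambda>x. (u x)\<^sup>2)}"

definition L2_norm :: "(real ^ 'n \<Rightarrow> 'b::real_normed_vector) \<Rightarrow> real" where
  "L2_norm u = sqrt (LINT x|lborel. (norm (u x))\<^sup>2)"

text \<open>On the diagonal, a null set, the quotient takes the value \<open>0\<close>.\<close>

definition gagliardo_integrand :: "real \<Rightarrow> (real ^ 'n \<Rightarrow> real) \<Rightarrow> (real ^ 'n) \<times> (real ^ 'n) \<Rightarrow> real" where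
  "gagliardo_integrand s u =
     (\<lambda>(x, y). \<bar>u x - u y\<bar>\<^sup>2 / norm (x - y) powr (real CARD('n) + 2 * s))"

definition gagliardo :: "real \<Rightarrow> (real ^ 'n \<Rightarrow> real) \<Rightarrow> real" where
  "gagliardo s u = (LINT z|(lborel \<Otimes>\<^sub>M lborel). gagliardo_integrand s u z)"

definition H_space :: "real \<Rightarrow> (real ^ 'n \<Rightarrow> real) set" where
  "H_space s = {u \<in> L2_space. integrable (lborel \<Otimes>\<^sub>M lborel) (gagliardo_integrand s u)}"

text \<open>
  The defining property of the normalization constant \<open>C\<^bsub>N,s\<^esub>\<close>; \<open>N\<close> is passed as a type.
  The functions below that depend on \<open>C\<^bsub>N,s\<^esub>\<close> have it as their argument \<open>C\<close>.
\<close>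

definition normalization_constant :: "'n::finite itself \<Rightarrow> real \<Rightarrow> real \<Rightarrow> bool" where
  "normalization_constant _ s C \<longleftrightarrow> C > 0 \<and>
     (\<forall>u :: real ^ 'n \<Rightarrow> real. test_function u \<longrightarrow>
        complex_of_real (C * gagliardo s u) =
          (LINT x|lborel. complex_of_real (u x) * frac_laplacian s (\<lambda>y. complex_of_real (u y)) x))"

definition grad_norm :: "real \<Rightarrow> real \<Rightarrow> (real ^ 'n \<Rightarrow> real) \<Rightarrow> real" where
  "grad_norm C s u = sqrt (C * gagliardo s u)"

definition Sigma_space :: "real \<Rightarrow> (real ^ 'n \<Rightarrow> real) set" where
  "Sigma_space s = {u \<in> H_space s. integrable lborel (\<lambda>x. (norm x)\<^sup>2 * (u x)\<^sup>2)}"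

definition Sigma_norm :: "real \<Rightarrow> real \<Rightarrow> (real ^ 'n \<Rightarrow> real) \<Rightarrow> real" where
  "Sigma_norm C s u = L2_norm u + grad_norm C s u + L2_norm (\<lambda>x. u x *\<^sub>R x)"

definition cSigma_space :: "real \<Rightarrow> (real ^ 'n \<Rightarrow> complex) set" where
  "cSigma_space s = {\<omega>. (\<lambda>x. Re (\<omega> x)) \<in> Sigma_space s \<and> (\<lambda>x. Im (\<omega> x)) \<in> Sigma_space s}"

definition cSigma_norm :: "real \<Rightarrow> real \<Rightarrow> (real ^ 'n \<Rightarrow> complex) \<Rightarrow> real" where
  "cSigma_norm C s \<omega> =
     sqrt ((Sigma_norm C s (\<lambda>x. Re (\<omega> x)))\<^sup>2 + (Sigma_norm C s (\<lambda>x. Im (\<omega> x)))\<^sup>2)"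

definition cgrad_norm :: "real \<Rightarrow> real \<Rightarrow> (real ^ 'n \<Rightarrow> complex) \<Rightarrow> real" where
  "cgrad_norm C s \<omega> =
     sqrt ((grad_norm C s (\<lambda>x. Re (\<omega> x)))\<^sup>2 + (grad_norm C s (\<lambda>x. Im (\<omega> x)))\<^sup>2)"

section \<open>Energy and ground states\<close>

definition energy :: "real \<Rightarrow> real \<Rightarrow> real \<Rightarrow> (real ^ 'n \<Rightarrow> complex) \<Rightarrow> real" where
  "energy C s \<sigma> \<psi> = (cgrad_norm C s \<psi>)\<^sup>2 +
     (LINT x|lborel. (norm x)\<^sup>2 * (cmod (\<psi> x))\<^sup>2 - 1 / (\<sigma> + 1) * cmod (\<psi> x) powr (2 * \<sigma> + 2))"

definition J_fun :: "real \<Rightarrow> real \<Rightarrow> real \<Rightarrow> (real ^ 'n \<Rightarrow> complex) \<Rightarrow> real" where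
  "J_fun C s \<sigma> \<omega> = 1 / 2 * (cgrad_norm C s \<omega>)\<^sup>2
     + 1 / 2 * (LINT x|lborel. (norm x)\<^sup>2 * (cmod (\<omega> x))\<^sup>2)
     - 1 / (2 * \<sigma> + 2) * (LINT x|lborel. cmod (\<omega> x) powr (2 * \<sigma> + 2))"

definition mass_sphere :: "real \<Rightarrow> real \<Rightarrow> (real ^ 'n \<Rightarrow> complex) set" where
  "mass_sphere s c = {\<omega> \<in> cSigma_space s. (LINT x|lborel. (cmod (\<omega> x))\<^sup>2) = c\<^sup>2}"

definition ground_states :: "real \<Rightarrow> real \<Rightarrow> real \<Rightarrow> real \<Rightarrow> (real ^ 'n \<Rightarrow> complex) set" where
  "ground_states C s \<sigma> c =
     {\<omega> \<in> mass_sphere s c. J_fun C s \<sigma> \<omega> =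
        (INF \<eta>\<in>(mass_sphere s c :: (real ^ 'n \<Rightarrow> complex) set). J_fun C s \<sigma> \<eta>)}"

section \<open>Cauchy problem and stability\<close>

text \<open>
  A solution is a continuous curve in the energy space that satisfies the equation at every time
  \<open>t \<ge> 0\<close> in the sense of distributions on \<open>\<real>\<^sup>N\<close>, the fractional Laplacian being transposed onto
  the test function by \<open>\<integral> ((-\<Delta>)\<^sup>s \<psi>) \<phi> = \<integral> \<psi> (-\<Delta>)\<^sup>s \<phi>\<close> (bilinear pairing, no conjugation).
  Only times \<open>t \<ge> 0\<close> matter; at \<open>t = 0\<close> limit and time derivative are one-sided.
\<close>

definition NLS_solution ::
    "real \<Rightarrow> real \<Rightarrow> real \<Rightarrow> (real ^ 'n \<Rightarrow> complex) \<Rightarrow> (real \<Rightarrow> real ^ 'n \<Rightarrow> complex) \<Rightarrow> bool" where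
  "NLS_solution C s \<sigma> \<psi>0 \<psi> \<longleftrightarrow>
     (\<forall>t\<ge>0. \<psi> t \<in> cSigma_space s) \<and>
     (\<forall>t\<ge>0. ((\<lambda>r. cSigma_norm C s (\<lambda>x. \<psi> r x - \<psi> t x)) \<longlongrightarrow> 0) (at t within {0..})) \<and>
     (AE x in lborel. \<psi> 0 x = \<psi>0 x) \<and>
     (\<forall>\<phi> :: real ^ 'n \<Rightarrow> complex. test_function \<phi> \<longrightarrow>
        (\<forall>t\<ge>0. \<exists>D. ((\<lambda>r. LINT x|lborel. \<psi> r x * \<phi> x) has_vector_derivative D) (at t within {0..}) \<and>
           \<i> * D = (LINT x|lborel. \<psi> t x * frac_laplacian s \<phi> x)
                 + (LINT x|lborel. complex_of_real ((norm x)\<^sup>2) * \<psi> t x * \<phi> x)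
                 - (LINT x|lborel. complex_of_real (cmod (\<psi> t x) powr (2 * \<sigma>)) * \<psi> t x * \<phi> x)))"

definition orbitally_stable :: "real \<Rightarrow> real \<Rightarrow> real \<Rightarrow> (real ^ 'n \<Rightarrow> complex) set \<Rightarrow> bool" where
  "orbitally_stable C s \<sigma> G \<longleftrightarrow> G \<noteq> {} \<and>
     (\<forall>\<omega>0\<in>G. \<forall>\<epsilon>>0. \<exists>\<delta>>0. \<forall>\<psi>0\<in>cSigma_space s.
        cSigma_norm C s (\<lambda>x. \<omega>0 x - \<psi>0 x) < \<delta> \<longrightarrow>
        (\<forall>\<psi>. NLS_solution C s \<sigma> \<psi>0 \<psi> \<longrightarrow>
           (\<forall>t\<ge>0. (INF \<omega>\<in>G. cSigma_norm C s (\<lambda>x. \<omega> x - \<psi> t x)) < \<epsilon>)))"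

end

theory Submission
  imports Defs "HOL-Complex_Analysis.Great_Picard"
begin

text \<open>
  Stability follows the argument of Cazenave and Lions: if every sequence whose masses tend to
  \<open>c\<^sup>2\<close> and whose energies tend to the minimum has a subsequence that converges in the energy space
  to a ground state (\<open>minimizing_sequence_precompact\<close>), then ground states exist, and a solution that
  starts near one cannot leave the neighbourhood of their set, since mass and energy are conserved.

  The compactness rests on two facts, both obtained by comparing a function with its means over
  the cells of a cubic grid of side \<open>h\<close>. By Cauchy-Schwarz, the squared oscillation about the cell
  mean at \<open>x\<close> is at most a constant times \<open>h powr (2 s)\<close> times the density at \<open>x\<close> of the Gagliardo
  seminorm (\<open>norm_diff_cell_mean_sq_le\<close>), while the squared mean is at most the mass divided by
  \<open>h ^ N\<close>.

  If \<open>h\<close> is chosen at each point so that the mean is at most half the value of the function there,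
  the first bound becomes a pointwise estimate of the power \<open>2 + 4 s / N\<close>. Integrated, it is the
  Gagliardo-Nirenberg inequality (\<open>fractional_Gagliardo_Nirenberg\<close>). Since \<open>\<sigma> < 2 s / N\<close>, the potential
  energy has a smaller exponent, so it is controlled at fixed mass by a small part of the kinetic
  energy, and the energy is bounded below and coercive.

  If instead \<open>h\<close> is small and fixed, a bounded sequence is uniformly close to its cell means. Those
  are countably many bounded sequences of numbers, so a diagonal subsequence makes them converge;
  the weight \<open>norm x\<close> excludes a loss of mass at infinity. Hence the energy space embeds compactly in
  \<open>L\<^sup>2\<close> (\<open>compact_embedding\<close>).

  Mass, Gagliardo seminorm and weighted norm are all treated as squared \<open>L\<^sup>2\<close> norms of linear images
  of the function. Fatou's lemma makes them lower semicontinuous under pointwise convergence, and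
  together with the parallelogram law it upgrades convergence of the norms to strong convergence
  (\<open>sq_norm_diff_tendsto_0\<close>).
\<close>

section \<open>Square-integrable vector-valued functions\<close>

definition sq_integrable :: "'a measure \<Rightarrow> ('a \<Rightarrow> 'b::euclidean_space) \<Rightarrow> bool" where
  "sq_integrable M g \<longleftrightarrow> g \<in> borel_measurable M \<and> integrable M (\<lambda>x. (norm (g x))\<^sup>2)"

definition sq_norm :: "'a measure \<Rightarrow> ('a \<Rightarrow> 'b::euclidean_space) \<Rightarrow> real" where
  "sq_norm M g = (LINT x|M. (norm (g x))\<^sup>2)"

lemma sq_norm_nonneg [simp]: "0 \<le> sq_norm M g"
  by (simp add: sq_norm_def)

lemma nn_integral_sq_norm:
  "sq_integrable M g \<Longrightarrow> (\<integral>\<^sup>+x. ennreal ((norm (g x))\<^sup>2) \<partial>M) = ennreal (sq_norm M g)"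
  by (simp add: sq_integrable_def sq_norm_def nn_integral_eq_integral)

lemma sq_integrable_of_nn_integral_le:
  assumes [measurable]: "g \<in> borel_measurable M"
    and le: "(\<integral>\<^sup>+x. ennreal ((norm (g x))\<^sup>2) \<partial>M) \<le> ennreal B"
  shows "sq_integrable M g" "0 \<le> B \<Longrightarrow> sq_norm M g \<le> B"
proof -
  have "(\<integral>\<^sup>+x. ennreal (norm ((norm (g x))\<^sup>2)) \<partial>M) < \<infinity>"
    using le by (simp add: le_less_trans[OF le])
  then show *: "sq_integrable M g"
    unfolding sq_integrable_def by (auto simp: integrable_iff_bounded)
  show "sq_norm M g \<le> B" if "0 \<le> B"
    using le that by (simp add: nn_integral_sq_norm[OF *])
qed

lemma norm_parallelogram:
  fixes a b :: "'b::real_inner"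
  shows "(norm (a + b))\<^sup>2 + (norm (a - b))\<^sup>2 = 2 * (norm a)\<^sup>2 + 2 * (norm b)\<^sup>2"
  by (simp add: power2_norm_eq_inner inner_add inner_diff inner_commute)

lemma norm_add_sq_le:
  fixes a b :: "'b::real_inner"
  shows "(norm (a + b))\<^sup>2 \<le> 2 * (norm a)\<^sup>2 + 2 * (norm b)\<^sup>2"
    and "(norm (a - b))\<^sup>2 \<le> 2 * (norm a)\<^sup>2 + 2 * (norm b)\<^sup>2"
  using norm_parallelogram[of a b] zero_le_power2[of "norm (a - b)"] zero_le_power2[of "norm (a + b)"]
  by linarith+

lemma sq_integrable_mono:
  assumes "sq_integrable M f" "g \<in> borel_measurable M"
    and "\<And>x. (norm (g x))\<^sup>2 \<le> K * (norm (f x))\<^sup>2"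
  shows "sq_integrable M g"
  unfolding sq_integrable_def
proof (intro conjI assms Bochner_Integration.integrable_bound[of M "\<lambda>x. K * (norm (f x))\<^sup>2" "\<lambda>x. (norm (g x))\<^sup>2"])
  show "integrable M (\<lambda>x. K * (norm (f x))\<^sup>2)" using assms by (simp add: sq_integrable_def)
  show "(\<lambda>x. (norm (g x))\<^sup>2) \<in> borel_measurable M" using assms(2) by measurable
  show "AE x in M. norm ((norm (g x))\<^sup>2) \<le> norm (K * (norm (f x))\<^sup>2)"
    using assms(3) by (intro AE_I2) (auto intro: order_trans[OF _ abs_ge_self])
qed

lemma
  assumes "sq_integrable M f" "sq_integrable M g"
  shows sq_integrable_add: "sq_integrable M (\<lambda>x. f x + g x)"
    and sq_integrable_diff: "sq_integrable M (\<lambda>x. f x - g x)"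
proof -
  have [measurable]: "f \<in> borel_measurable M" "g \<in> borel_measurable M"
    using assms by (auto simp: sq_integrable_def)
  have i: "integrable M (\<lambda>x. 2 * (norm (f x))\<^sup>2 + 2 * (norm (g x))\<^sup>2)"
    using assms by (auto simp: sq_integrable_def)
  show "sq_integrable M (\<lambda>x. f x + g x)" "sq_integrable M (\<lambda>x. f x - g x)"
    unfolding sq_integrable_def
    by (auto intro!: Bochner_Integration.integrable_bound[OF i] AE_I2 order_trans[OF norm_add_sq_le(1)] order_trans[OF norm_add_sq_le(2)])
qed

lemma sq_integrable_scaleR: "sq_integrable M f \<Longrightarrow> sq_integrable M (\<lambda>x. a *\<^sub>R f x)"
  by (auto simp: sq_integrable_def power_mult_distrib)

lemma sq_norm_scaleR: "sq_norm M (\<lambda>x. a *\<^sub>R f x) = a\<^sup>2 * sq_norm M f"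
  by (simp add: sq_norm_def power_mult_distrib)

lemma sq_norm_parallelogram:
  assumes "sq_integrable M f" "sq_integrable M g"
  shows "sq_norm M (\<lambda>x. f x + g x) + sq_norm M (\<lambda>x. f x - g x) = 2 * sq_norm M f + 2 * sq_norm M g"
proof -
  have "sq_norm M (\<lambda>x. f x + g x) + sq_norm M (\<lambda>x. f x - g x)
      = (LINT x|M. (norm (f x + g x))\<^sup>2 + (norm (f x - g x))\<^sup>2)"
    using sq_integrable_add[OF assms] sq_integrable_diff[OF assms]
    by (simp add: sq_norm_def sq_integrable_def)
  also have "\<dots> = (LINT x|M. 2 * (norm (f x))\<^sup>2 + 2 * (norm (g x))\<^sup>2)"
    by (simp only: norm_parallelogram)
  also have "\<dots> = 2 * sq_norm M f + 2 * sq_norm M g"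
    using assms by (simp add: sq_norm_def sq_integrable_def)
  finally show ?thesis .
qed

lemma sq_norm_diff_le:
  assumes "sq_integrable M f" "sq_integrable M g"
  shows "sq_norm M (\<lambda>x. f x - g x) \<le> 2 * sq_norm M f + 2 * sq_norm M g"
  using sq_norm_parallelogram[OF assms] sq_norm_nonneg[of M "\<lambda>x. f x + g x"] by linarith

lemma sq_norm_Fatou:
  assumes f: "\<And>n. sq_integrable M (f n)" and g[measurable]: "g \<in> borel_measurable M"
    and lim: "AE x in M. (\<lambda>n. f n x) \<longlonglongrightarrow> g x"
  shows "(\<integral>\<^sup>+x. ennreal ((norm (g x))\<^sup>2) \<partial>M) \<le> liminf (\<lambda>n. ennreal (sq_norm M (f n)))"
proof -
  have [measurable]: "f n \<in> borel_measurable M" for n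
    using f by (auto simp: sq_integrable_def)
  have "(\<integral>\<^sup>+x. ennreal ((norm (g x))\<^sup>2) \<partial>M) = (\<integral>\<^sup>+x. liminf (\<lambda>n. ennreal ((norm (f n x))\<^sup>2)) \<partial>M)"
  proof (rule nn_integral_cong_AE)
    show "AE x in M. ennreal ((norm (g x))\<^sup>2) = liminf (\<lambda>n. ennreal ((norm (f n x))\<^sup>2))"
      using lim
    proof eventually_elim
      case (elim x)
      then have "(\<lambda>n. ennreal ((norm (f n x))\<^sup>2)) \<longlonglongrightarrow> ennreal ((norm (g x))\<^sup>2)"
        by (intro tendsto_ennrealI tendsto_power tendsto_norm)
      from lim_imp_Liminf[OF sequentially_bot this] show ?case by simp
    qed
  qed
  also have "\<dots> \<le> liminf (\<lambda>n. \<integral>\<^sup>+x. ennreal ((norm (f n x))\<^sup>2) \<partial>M)"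
    by (intro nn_integral_liminf) measurable
  finally show ?thesis by (simp add: nn_integral_sq_norm[OF f])
qed

lemma
  assumes f: "\<And>n. sq_integrable M (f n)" and g[measurable]: "g \<in> borel_measurable M"
    and lim: "AE x in M. (\<lambda>n. f n x) \<longlonglongrightarrow> g x"
    and B: "0 \<le> B" "\<forall>\<^sub>F n in sequentially. sq_norm M (f n) \<le> B"
  shows sq_integrable_AE_limit: "sq_integrable M g" and sq_norm_AE_limit_le: "sq_norm M g \<le> B"
proof -
  have "liminf (\<lambda>n. ennreal (sq_norm M (f n))) \<le> liminf (\<lambda>n. ennreal B)"
    using B(2) by (intro Liminf_mono) (auto elim!: eventually_mono simp: ennreal_leI)
  then have "(\<integral>\<^sup>+x. ennreal ((norm (g x))\<^sup>2) \<partial>M) \<le> ennreal B"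
    using sq_norm_Fatou[OF f g lim] by (simp add: Liminf_const)
  from sq_integrable_of_nn_integral_le[OF g this] B
  show "sq_integrable M g" "sq_norm M g \<le> B" by auto
qed

lemma sq_norm_lower_semicontinuous:
  assumes f: "\<And>n. sq_integrable M (f n)" and g: "sq_integrable M g"
    and lim: "AE x in M. (\<lambda>n. f n x) \<longlonglongrightarrow> g x" and y: "y < sq_norm M g"
  shows "\<forall>\<^sub>F n in sequentially. y < sq_norm M (f n)"
proof (cases "y < 0")
  case True
  then show ?thesis by (auto intro!: always_eventually less_le_trans[OF _ sq_norm_nonneg])
next
  case False
  have "ennreal (sq_norm M g) \<le> liminf (\<lambda>n. ennreal (sq_norm M (f n)))"
    using sq_norm_Fatou[OF f _ lim] g by (simp add: nn_integral_sq_norm[OF g]) (auto simp: sq_integrable_def)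
  then have "\<forall>\<^sub>F n in sequentially. ennreal y < ennreal (sq_norm M (f n))"
    using y False unfolding le_Liminf_iff by (elim allE[of _ "ennreal y"]) (simp add: ennreal_less_iff)
  then show ?thesis using False by (simp add: ennreal_less_iff)
qed

text \<open>
  The parallelogram law turns lower semicontinuity into strong convergence: the norms of
  \<open>f n + g\<close> cannot drop below that of \<open>2 g\<close> in the limit, so those of \<open>f n - g\<close> are squeezed to zero.
\<close>

lemma sq_norm_diff_tendsto_0:
  assumes f: "\<And>n. sq_integrable M (f n)" and g: "sq_integrable M g"
    and lim: "AE x in M. (\<lambda>n. f n x) \<longlonglongrightarrow> g x"
    and norms: "(\<lambda>n. sq_norm M (f n)) \<longlonglongrightarrow> sq_norm M g"
  shows "(\<lambda>n. sq_norm M (\<lambda>x. f n x - g x)) \<longlonglongrightarrow> 0"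
proof (rule order_tendstoI)
  show "\<forall>\<^sub>F n in sequentially. a < sq_norm M (\<lambda>x. f n x - g x)" if "a < 0" for a
    using that by (auto intro!: always_eventually less_le_trans[OF _ sq_norm_nonneg])
  fix e :: real assume e: "0 < e"
  have "AE x in M. (\<lambda>n. f n x + g x) \<longlonglongrightarrow> 2 *\<^sub>R g x"
    using lim by eventually_elim (auto simp: scaleR_2 intro!: tendsto_intros)
  then have "\<forall>\<^sub>F n in sequentially. 4 * sq_norm M g - e / 2 < sq_norm M (\<lambda>x. f n x + g x)"
    using e sq_norm_scaleR[of M 2 g]
    by (intro sq_norm_lower_semicontinuous[where g="\<lambda>x. 2 *\<^sub>R g x"] sq_integrable_add f g sq_integrable_scaleR) auto
  moreover have "\<forall>\<^sub>F n in sequentially. sq_norm M (f n) < sq_norm M g + e / 4"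
    using e by (intro order_tendstoD(2)[OF norms]) auto
  ultimately show "\<forall>\<^sub>F n in sequentially. sq_norm M (\<lambda>x. f n x - g x) < e"
  proof eventually_elim
    case (elim n)
    with sq_norm_parallelogram[OF f[of n] g] show ?case by linarith
  qed
qed

lemma tendsto_if_dominated_up_to_epsilon:
  fixes a d :: "nat \<Rightarrow> real"
  assumes d: "d \<longlonglongrightarrow> 0" and bnd: "\<And>e. 0 < e \<Longrightarrow> \<exists>K. \<forall>n. \<bar>a n - l\<bar> \<le> e + K * d n"
  shows "a \<longlonglongrightarrow> l"
proof (rule tendstoI)
  fix e :: real assume "0 < e"
  then obtain K where K: "\<And>n. \<bar>a n - l\<bar> \<le> e / 2 + K * d n" using bnd[of "e/2"] by auto
  have "(\<lambda>n. K * d n) \<longlonglongrightarrow> 0" using tendsto_mult[OF tendsto_const d, of K] by simp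
  then have "\<forall>\<^sub>F n in sequentially. K * d n < e / 2"
    using \<open>0 < e\<close> by (intro order_tendstoD(2)) auto
  then show "\<forall>\<^sub>F n in sequentially. dist (a n) l < e"
  proof eventually_elim
    case (elim n)
    with K[of n] show ?case by (auto simp: dist_real_def)
  qed
qed

lemma sq_norm_tendsto:
  fixes f :: "nat \<Rightarrow> 'a \<Rightarrow> 'b::euclidean_space"
  assumes f: "\<And>n. sq_integrable M (f n)" and g: "sq_integrable M g"
    and lim: "(\<lambda>n. sq_norm M (\<lambda>x. f n x - g x)) \<longlonglongrightarrow> 0"
  shows "(\<lambda>n. sq_norm M (f n)) \<longlonglongrightarrow> sq_norm M g"
proof (rule tendsto_if_dominated_up_to_epsilon[OF lim])
  fix e :: real assume e: "0 < e"
  define d where "d = e / (sq_norm M g + 1)"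
  have d: "0 < d" unfolding d_def using e by (intro divide_pos_pos add_nonneg_pos) auto
  have pointwise: "\<bar>(norm a)\<^sup>2 - (norm b)\<^sup>2\<bar> \<le> d * (norm b)\<^sup>2 + (1 + 1 / d) * (norm (a - b))\<^sup>2" for a b :: 'b
  proof -
    let ?t = "norm a - norm b"
    have "\<bar>(norm a)\<^sup>2 - (norm b)\<^sup>2\<bar> = \<bar>?t * ?t + 2 * norm b * ?t\<bar>"
      by (simp add: power2_eq_square algebra_simps)
    also have "\<dots> \<le> \<bar>?t * ?t\<bar> + \<bar>2 * norm b * ?t\<bar>" by (rule abs_triangle_ineq)
    also have "\<dots> = ?t\<^sup>2 + 2 * norm b * \<bar>?t\<bar>" by (simp add: abs_mult power2_eq_square)
    also have "2 * norm b * \<bar>?t\<bar> \<le> d * (norm b)\<^sup>2 + ?t\<^sup>2 / d"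
    proof -
      have "0 \<le> (d * norm b - \<bar>?t\<bar>)\<^sup>2 / d" using d by simp
      also have "\<dots> = d * (norm b)\<^sup>2 + ?t\<^sup>2 / d - 2 * norm b * \<bar>?t\<bar>"
        using d by (simp add: power2_eq_square field_simps)
      finally show ?thesis by simp
    qed
    also have "?t\<^sup>2 + (d * (norm b)\<^sup>2 + ?t\<^sup>2 / d) = d * (norm b)\<^sup>2 + (1 + 1 / d) * ?t\<^sup>2"
      by (simp add: field_simps)
    also have "\<dots> \<le> d * (norm b)\<^sup>2 + (1 + 1 / d) * (norm (a - b))\<^sup>2"
      using d norm_triangle_ineq3[of a b] by (intro add_left_mono mult_left_mono abs_le_square_iff[THEN iffD1]) auto
    finally show ?thesis by simp
  qed
  have "\<bar>sq_norm M (f n) - sq_norm M g\<bar> \<le> e + (1 + 1 / d) * sq_norm M (\<lambda>x. f n x - g x)" for n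
  proof -
    note i = f[of n, unfolded sq_integrable_def] g[unfolded sq_integrable_def]
      sq_integrable_diff[OF f[of n] g, unfolded sq_integrable_def]
    have "\<bar>sq_norm M (f n) - sq_norm M g\<bar> = \<bar>LINT x|M. (norm (f n x))\<^sup>2 - (norm (g x))\<^sup>2\<bar>"
      using i by (simp add: sq_norm_def)
    also have "\<dots> \<le> (LINT x|M. \<bar>(norm (f n x))\<^sup>2 - (norm (g x))\<^sup>2\<bar>)"
      by (rule integral_abs_bound)
    also have "\<dots> \<le> (LINT x|M. d * (norm (g x))\<^sup>2 + (1 + 1 / d) * (norm (f n x - g x))\<^sup>2)"
      using i by (intro integral_mono pointwise) auto
    also have "\<dots> = d * sq_norm M g + (1 + 1 / d) * sq_norm M (\<lambda>x. f n x - g x)"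
      using i by (simp add: sq_norm_def)
    also have "d * sq_norm M g \<le> e"
    proof -
      have "sq_norm M g + 1 > 0" by (intro add_nonneg_pos) auto
      then have "d * (sq_norm M g + 1) = e" by (simp add: d_def)
      then show ?thesis using d by (simp add: distrib_left)
    qed
    finally show ?thesis by simp
  qed
  then show "\<exists>K. \<forall>n. \<bar>sq_norm M (f n) - sq_norm M g\<bar> \<le> e + K * sq_norm M (\<lambda>x. f n x - g x)"
    by blast
qed

text \<open>
  A Cauchy sequence in the mean square has a subsequence whose increments \<open>d k\<close> satisfy
  \<open>sq_norm (d k) < 1 / 8 ^ k\<close>. Then \<open>\<Sum> 2 ^ k * (norm (d k))\<^sup>2\<close> has a finite integral, so almost
  everywhere the increments decay geometrically and the subsequence converges pointwise.
\<close>

lemma sq_norm_Cauchy_AE_subsequence: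
  fixes f :: "nat \<Rightarrow> 'a \<Rightarrow> 'b::euclidean_space"
  assumes f: "\<And>n. sq_integrable M (f n)"
    and Cauchy: "\<And>e. 0 < e \<Longrightarrow> \<exists>N. \<forall>m\<ge>N. \<forall>n\<ge>N. sq_norm M (\<lambda>x. f m x - f n x) < e"
  obtains r g where "strict_mono r" "sq_integrable M g" "AE x in M. (\<lambda>n. f (r n) x) \<longlonglongrightarrow> g x"
    "(\<lambda>n. sq_norm M (\<lambda>x. f (r n) x - g x)) \<longlonglongrightarrow> 0"
proof -
  have meas[measurable]: "f n \<in> borel_measurable M" for n
    using f by (auto simp: sq_integrable_def)
  have "\<exists>r. \<forall>k. (\<forall>m\<ge>r k. \<forall>n\<ge>r k. sq_norm M (\<lambda>x. f m x - f n x) < 1 / 8 ^ k) \<and> r k < r (Suc k)"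
  proof (rule dependent_nat_choice)
    show "\<exists>x. \<forall>m\<ge>x. \<forall>n\<ge>x. sq_norm M (\<lambda>xa. f m xa - f n xa) < 1 / 8 ^ 0"
      using Cauchy[of 1] by auto
    fix x k :: nat
    obtain N where "\<forall>m\<ge>N. \<forall>n\<ge>N. sq_norm M (\<lambda>x. f m x - f n x) < 1 / 8 ^ Suc k"
      using Cauchy[of "1 / 8 ^ Suc k"] by auto
    then show "\<exists>y. (\<forall>m\<ge>y. \<forall>n\<ge>y. sq_norm M (\<lambda>x. f m x - f n x) < 1 / 8 ^ Suc k) \<and> x < y"
      by (intro exI[of _ "max N (Suc x)"]) auto
  qed
  then obtain r where r: "\<And>k m n. m \<ge> r k \<Longrightarrow> n \<ge> r k \<Longrightarrow> sq_norm M (\<lambda>x. f m x - f n x) < 1 / 8 ^ k"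
    and mono: "\<And>k. r k < r (Suc k)" by blast
  have sm: "strict_mono r" using mono by (simp add: strict_mono_Suc_iff)
  define d where "d k x = f (r (Suc k)) x - f (r k) x" for k x
  have [measurable]: "d k \<in> borel_measurable M" for k unfolding d_def by measurable
  have d: "sq_integrable M (d k)" for k unfolding d_def by (intro sq_integrable_diff f)
  have "(\<integral>\<^sup>+x. (\<Sum>k. ennreal (2 ^ k * (norm (d k x))\<^sup>2)) \<partial>M) = (\<Sum>k. \<integral>\<^sup>+x. ennreal (2 ^ k * (norm (d k x))\<^sup>2) \<partial>M)"
    by (intro nn_integral_suminf) measurable
  also have "\<dots> \<le> (\<Sum>k. ennreal ((1/4) ^ k))"
  proof (intro suminf_le summableI)
    fix k
    have "(\<integral>\<^sup>+x. ennreal (2 ^ k * (norm (d k x))\<^sup>2) \<partial>M) = ennreal (2 ^ k) * (\<integral>\<^sup>+x. ennreal ((norm (d k x))\<^sup>2) \<partial>M)"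
      by (subst nn_integral_cmult[symmetric]) (auto simp: ennreal_mult)
    also have "\<dots> = ennreal (2 ^ k * sq_norm M (d k))"
      by (simp add: nn_integral_sq_norm[OF d] ennreal_mult)
    also have "\<dots> \<le> ennreal ((1/4) ^ k)"
    proof (rule ennreal_leI)
      have "sq_norm M (d k) \<le> 1 / 8 ^ k"
        using r[of k "r (Suc k)" "r k"] mono[of k] unfolding d_def by auto
      then have "2 ^ k * sq_norm M (d k) \<le> 2 ^ k * (1 / 8 ^ k)" by (intro mult_left_mono) auto
      also have "\<dots> = (1/4) ^ k" by (simp add: power_divide[symmetric])
      finally show "2 ^ k * sq_norm M (d k) \<le> (1/4) ^ k" .
    qed
    finally show "(\<integral>\<^sup>+x. ennreal (2 ^ k * (norm (d k x))\<^sup>2) \<partial>M) \<le> ennreal ((1/4) ^ k)" .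
  qed
  also have "\<dots> < \<infinity>"
    by (subst suminf_ennreal_eq[OF _ sums_iff[THEN iffD2, OF conjI[OF summable_geometric refl]]]) auto
  finally have "AE x in M. (\<Sum>k. ennreal (2 ^ k * (norm (d k x))\<^sup>2)) \<noteq> \<infinity>"
    by (intro nn_integral_PInf_AE) auto
  then have conv: "AE x in M. convergent (\<lambda>k. f (r k) x)"
  proof eventually_elim
    case (elim x)
    have "summable (\<lambda>k. 2 ^ k * (norm (d k x))\<^sup>2)"
      using elim by (intro summable_suminf_not_top) auto
    then have "Bseq (\<lambda>k. 2 ^ k * (norm (d k x))\<^sup>2)"
      by (intro convergent_imp_Bseq convergentI[OF summable_LIMSEQ_zero])
    then obtain S where S: "0 < S" "\<And>k. norm (2 ^ k * (norm (d k x))\<^sup>2) \<le> S" by (auto simp: Bseq_def)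
    have "norm (d k x) \<le> sqrt S * (1 / sqrt 2) ^ k" for k
    proof -
      have "(norm (d k x))\<^sup>2 \<le> S / 2 ^ k" using S(2)[of k] by (simp add: field_simps)
      then have "norm (d k x) \<le> sqrt (S / 2 ^ k)" by (rule real_le_rsqrt)
      also have "\<dots> = sqrt S * (1 / sqrt 2) ^ k"
        by (simp add: real_sqrt_divide real_sqrt_power power_divide)
      finally show ?thesis .
    qed
    then have "summable (\<lambda>k. d k x)"
      by (intro summable_comparison_test'[OF summable_mult[OF summable_geometric], of "1 / sqrt 2" 0 _ "sqrt S"]) auto
    then have "convergent (\<lambda>n. \<Sum>k<n. d k x)" by (simp add: summable_iff_convergent)
    moreover have "(\<Sum>k<n. d k x) = f (r n) x - f (r 0) x" for n
      unfolding d_def by (rule sum_lessThan_telescope)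
    ultimately have "convergent (\<lambda>n. (f (r n) x - f (r 0) x) + f (r 0) x)"
      by (intro convergent_add convergent_const) simp
    then show ?case by simp
  qed
  define g where "g x = lim (\<lambda>k. f (r k) x)" for x
  have g[measurable]: "g \<in> borel_measurable M" unfolding g_def by measurable
  have lim: "AE x in M. (\<lambda>n. f (r n) x) \<longlonglongrightarrow> g x"
    using conv by eventually_elim (simp add: g_def convergent_LIMSEQ_iff)
  have diff: "sq_integrable M (\<lambda>x. f (r n) x - g x) \<and> sq_norm M (\<lambda>x. f (r n) x - g x) \<le> 1 / 8 ^ n" for n
  proof -
    have l: "AE x in M. (\<lambda>m. f (r n) x - f (r m) x) \<longlonglongrightarrow> f (r n) x - g x"
      using lim by eventually_elim (intro tendsto_intros)
    have e: "\<forall>\<^sub>F m in sequentially. sq_norm M (\<lambda>x. f (r n) x - f (r m) x) \<le> 1 / 8 ^ n"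
      using r[of n "r n"] strict_mono_mono[OF sm, THEN monoD] less_imp_le
      unfolding eventually_sequentially by blast
    show ?thesis
      using sq_integrable_AE_limit[OF _ _ l _ e] sq_norm_AE_limit_le[OF _ _ l _ e] f
      by (simp add: sq_integrable_diff)
  qed
  have pow: "(\<lambda>n. 1 / 8 ^ n :: real) \<longlonglongrightarrow> 0"
    using LIMSEQ_power_zero[of "1/8::real"] by (simp add: power_divide)
  have lim0: "(\<lambda>n. sq_norm M (\<lambda>x. f (r n) x - g x)) \<longlonglongrightarrow> 0"
    by (rule tendsto_sandwich[OF _ _ tendsto_const pow]) (use diff in auto)
  have "sq_integrable M g"
    using sq_integrable_diff[OF f[of "r 0"] conjunct1[OF diff[of 0]]] by simp
  from that[OF sm this lim lim0] show ?thesis .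
qed

lemma Cauchy_Schwarz_on_set:
  assumes A: "A \<in> sets M" and g[measurable]: "g \<in> borel_measurable M" and fin: "emeasure M A < \<infinity>"
  shows "(\<integral>\<^sup>+x\<in>A. ennreal (norm (g x)) \<partial>M)\<^sup>2 \<le> emeasure M A * (\<integral>\<^sup>+x\<in>A. ennreal ((norm (g x))\<^sup>2) \<partial>M)"
proof -
  note [measurable] = A
  have i: "(indicator A x :: ennreal)\<^sup>2 = indicator A x" for x by (auto simp: indicator_def)
  have "(\<integral>\<^sup>+x. indicator A x * (ennreal (norm (g x)) * indicator A x) \<partial>M)\<^sup>2
      \<le> (\<integral>\<^sup>+x. (indicator A x)\<^sup>2 \<partial>M) * (\<integral>\<^sup>+x. (ennreal (norm (g x)) * indicator A x)\<^sup>2 \<partial>M)"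
    by (intro Cauchy_Schwarz_nn_integral) measurable
  moreover have "indicator A x * (ennreal (norm (g x)) * indicator A x) = ennreal (norm (g x)) * indicator A x" for x
    by (auto simp: indicator_def)
  ultimately show ?thesis by (simp add: power_mult_distrib i ennreal_power)
qed

section \<open>Averages over the cells of a cubic grid\<close>

lemma ennreal_norm_set_integral_sq_le:
  fixes g :: "'a \<Rightarrow> 'b::euclidean_space"
  assumes A: "A \<in> sets M" and g: "g \<in> borel_measurable M" and fin: "emeasure M A < \<infinity>"
  shows "ennreal ((norm (LINT x:A|M. g x))\<^sup>2) \<le> emeasure M A * (\<integral>\<^sup>+x\<in>A. ennreal ((norm (g x))\<^sup>2) \<partial>M)"
proof (cases "set_integrable M A g")
  case True
  then have n: "integrable M (\<lambda>x. norm (indicator A x *\<^sub>R g x))"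
    unfolding set_integrable_def by (rule integrable_norm)
  have "ennreal (norm (LINT x:A|M. g x)) \<le> ennreal (LINT x|M. norm (indicator A x *\<^sub>R g x))"
    unfolding set_lebesgue_integral_def by (intro ennreal_leI integral_norm_bound)
  also have "\<dots> = (\<integral>\<^sup>+x. ennreal (norm (indicator A x *\<^sub>R g x)) \<partial>M)"
    using n by (simp add: nn_integral_eq_integral)
  also have "\<dots> = (\<integral>\<^sup>+x\<in>A. ennreal (norm (g x)) \<partial>M)"
    by (intro nn_integral_cong) (auto simp: indicator_def)
  finally have "(ennreal (norm (LINT x:A|M. g x)))\<^sup>2 \<le> (\<integral>\<^sup>+x\<in>A. ennreal (norm (g x)) \<partial>M)\<^sup>2"
    by (intro power_mono) auto
  also note Cauchy_Schwarz_on_set[OF A g fin]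
  finally show ?thesis by (simp add: ennreal_power)
next
  case False
  then show ?thesis
    by (simp add: set_integrable_def set_lebesgue_integral_def not_integrable_integral_eq)
qed

lemma sq_integrable_imp_set_integrable:
  assumes g: "sq_integrable M g" and A: "A \<in> sets M" and fin: "emeasure M A < \<infinity>"
  shows "set_integrable M A g"
proof -
  have [measurable]: "g \<in> borel_measurable M" using g by (simp add: sq_integrable_def)
  note [measurable] = A
  have "(\<integral>\<^sup>+x\<in>A. ennreal ((norm (g x))\<^sup>2) \<partial>M) \<le> (\<integral>\<^sup>+x. ennreal ((norm (g x))\<^sup>2) \<partial>M)"
    by (intro nn_integral_mono) (auto simp: indicator_def)
  also have "\<dots> < \<infinity>" using nn_integral_sq_norm[OF g] by simp
  finally have "emeasure M A * (\<integral>\<^sup>+x\<in>A. ennreal ((norm (g x))\<^sup>2) \<partial>M) < \<infinity>"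
    using fin by (simp add: ennreal_mult_less_top)
  with Cauchy_Schwarz_on_set[OF A _ fin, of g] have "(\<integral>\<^sup>+x\<in>A. ennreal (norm (g x)) \<partial>M)\<^sup>2 < \<infinity>"
    by (auto intro: le_less_trans)
  then have "(\<integral>\<^sup>+x\<in>A. ennreal (norm (g x)) \<partial>M) < \<infinity>"
    by (simp add: power_less_top_ennreal)
  moreover have "(\<integral>\<^sup>+x. ennreal (norm (indicator A x *\<^sub>R g x)) \<partial>M) = (\<integral>\<^sup>+x\<in>A. ennreal (norm (g x)) \<partial>M)"
    by (intro nn_integral_cong) (auto simp: indicator_def)
  ultimately show ?thesis
    unfolding set_integrable_def by (simp add: integrable_iff_bounded)
qed

definition cell_index :: "real \<Rightarrow> real ^ 'n \<Rightarrow> 'n \<Rightarrow> int" where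
  "cell_index h x = (\<lambda>i. \<lfloor>x $ i / h\<rfloor>)"

definition cell :: "real \<Rightarrow> ('n \<Rightarrow> int) \<Rightarrow> (real ^ 'n) set" where
  "cell h m = {y. cell_index h y = m}"

definition cell_mean :: "real \<Rightarrow> (real ^ 'n \<Rightarrow> 'b::euclidean_space) \<Rightarrow> ('n \<Rightarrow> int) \<Rightarrow> 'b" where
  "cell_mean h f m = (1 / h ^ CARD('n)) *\<^sub>R (LINT y:cell h m|lborel. f y)"

lemma cell_eq:
  assumes "0 < h"
  shows "cell h m = {y. \<forall>i. of_int (m i) * h \<le> y $ i \<and> y $ i < (of_int (m i) + 1) * h}"
  using assms by (auto simp: cell_def cell_index_def fun_eq_iff floor_eq_iff field_simps)

lemma borel_measurable_vec_component [measurable]: "(\<lambda>x::real^'n. x $ i) \<in> borel_measurable borel"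
  by (intro borel_measurable_continuous_onI continuous_intros)

lemma sets_cell [measurable]: "0 < h \<Longrightarrow> cell h (m :: 'n::finite \<Rightarrow> int) \<in> sets borel"
proof -
  assume "0 < h"
  then have "cell h m = (\<Inter>i\<in>UNIV. {y \<in> space borel. of_int (m i) * h \<le> y $ i \<and> y $ i < (of_int (m i) + 1) * h})"
    by (auto simp: cell_eq)
  also have "\<dots> \<in> sets borel" by (intro sets.finite_INT) auto
  finally show ?thesis .
qed

lemma emeasure_cell:
  assumes h: "0 < h"
  shows "emeasure lborel (cell h (m :: 'n::finite \<Rightarrow> int)) = ennreal (h ^ CARD('n))"
proof -
  define a b :: "real^'n" where "a = (\<chi> i. of_int (m i) * h)" and "b = (\<chi> i. (of_int (m i) + 1) * h)"
  have inner: "(b - a) \<bullet> k = h" if "k \<in> Basis" for k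
    using that by (auto simp: a_def b_def Basis_vec_def inner_axis algebra_simps)
  then have le: "\<And>k. k \<in> Basis \<Longrightarrow> a \<bullet> k \<le> b \<bullet> k"
    using h by (metis diff_ge_0_iff_ge inner_diff_left less_imp_le)
  have v: "(\<Prod>k\<in>Basis. (b - a) \<bullet> k) = h ^ CARD('n)" using inner by simp
  have sub: "box a b \<subseteq> cell h m" "cell h m \<subseteq> cbox a b"
    using h by (auto simp: cell_eq mem_box_cart a_def b_def less_imp_le)
  have m[measurable]: "cell h m \<in> sets lborel" using h by simp
  have "emeasure lborel (box a b) \<le> emeasure lborel (cell h m)"
    using sub m by (intro emeasure_mono)
  moreover have "emeasure lborel (cell h m) \<le> emeasure lborel (cbox a b)"
    using sub by (intro emeasure_mono) auto
  ultimately show ?thesis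
    using emeasure_lborel_cbox[OF le] emeasure_lborel_box[OF le] v by simp
qed

lemma norm_diff_le_of_cell:
  fixes x y :: "real^'n"
  assumes h: "0 < h" and y: "y \<in> cell h (cell_index h x)"
  shows "norm (x - y) \<le> real CARD('n) * h"
proof -
  have "x \<in> cell h (cell_index h x)" by (simp add: cell_def)
  with y h have "\<bar>(x - y) $ i\<bar> \<le> h" for i
    by (simp add: cell_eq abs_le_iff algebra_simps) (meson add_mono less_imp_le order_trans add_le_cancel_left)
  then have "(\<Sum>i\<in>UNIV. \<bar>(x - y) $ i\<bar>) \<le> (\<Sum>i\<in>(UNIV::'n set). h)" by (intro sum_mono)
  with norm_le_l1_cart[of "x - y"] show ?thesis by simp
qed

lemma norm_cell_mean_sq_le:
  fixes f :: "real^'n \<Rightarrow> 'b::euclidean_space"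
  assumes h: "0 < h" and f: "sq_integrable lborel f"
  shows "(norm (cell_mean h f m))\<^sup>2 \<le> sq_norm lborel f / h ^ CARD('n)"
proof -
  have [measurable]: "f \<in> borel_measurable lborel" using f by (simp add: sq_integrable_def)
  have "ennreal ((norm (LINT y:cell h m|lborel. f y))\<^sup>2)
      \<le> ennreal (h ^ CARD('n)) * (\<integral>\<^sup>+y\<in>cell h m. ennreal ((norm (f y))\<^sup>2) \<partial>lborel)"
    using h ennreal_norm_set_integral_sq_le[of "cell h m" lborel f] by (simp add: emeasure_cell)
  also have "\<dots> \<le> ennreal (h ^ CARD('n)) * (\<integral>\<^sup>+y. ennreal ((norm (f y))\<^sup>2) \<partial>lborel)"
    by (intro mult_left_mono nn_integral_mono) (auto simp: indicator_def)
  also have "\<dots> = ennreal (h ^ CARD('n) * sq_norm lborel f)"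
    using h by (simp add: nn_integral_sq_norm[OF f] ennreal_mult)
  finally have "(norm (LINT y:cell h m|lborel. f y))\<^sup>2 \<le> h ^ CARD('n) * sq_norm lborel f"
    using h by (subst (asm) ennreal_le_iff) auto
  then show ?thesis using h
    by (simp add: cell_mean_def power_divide power2_eq_square[of "h ^ _"] field_simps)
qed

section \<open>The Gagliardo seminorm\<close>

lemma powr_half_sq: "(t powr (a / 2))\<^sup>2 = t powr (a::real)"
  by (simp add: power2_eq_square flip: powr_add)

text \<open>
  The square root of the Gagliardo integrand, taken before the absolute value: it is linear in
  the function, and the seminorm is the \<open>L\<^sup>2\<close> norm of this image on the product space.
\<close>

definition gag_quotient :: "real \<Rightarrow> (real ^ 'n \<Rightarrow> 'b::euclidean_space) \<Rightarrow> (real ^ 'n) \<times> (real ^ 'n) \<Rightarrow> 'b" where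
  "gag_quotient s f = (\<lambda>(x, y). (f x - f y) /\<^sub>R norm (x - y) powr ((real CARD('n) + 2 * s) / 2))"

definition gag_density :: "real \<Rightarrow> (real ^ 'n \<Rightarrow> 'b::euclidean_space) \<Rightarrow> real ^ 'n \<Rightarrow> ennreal" where
  "gag_density s f x = (\<integral>\<^sup>+y. ennreal ((norm (gag_quotient s f (x, y)))\<^sup>2) \<partial>lborel)"

lemma norm_gag_quotient_sq:
  fixes f :: "real ^ 'n \<Rightarrow> 'b::euclidean_space"
  shows "(norm (gag_quotient s f (x, y)))\<^sup>2 = (norm (f x - f y))\<^sup>2 / norm (x - y) powr (real CARD('n) + 2 * s)"
proof -
  define D where "D = norm (x - y) powr ((real CARD('n) + 2 * s) / 2)"
  have D: "D\<^sup>2 = norm (x - y) powr (real CARD('n) + 2 * s)"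
    unfolding D_def by (rule powr_half_sq)
  have n: "norm (gag_quotient s f (x, y)) = norm (f x - f y) / D"
  proof -
   have "gag_quotient s f (x, y) = inverse D *\<^sub>R (f x - f y)"
     unfolding gag_quotient_def prod.case D_def ..
   moreover have "0 \<le> D" unfolding D_def by (rule powr_ge_zero)
   ultimately show ?thesis by (simp add: divide_inverse mult.commute)
  qed
  then show ?thesis by (simp only: power_divide D)
qed

lemma gag_quotient_measurable [measurable]:
  assumes [measurable]: "f \<in> borel_measurable lborel"
  shows "gag_quotient s f \<in> borel_measurable (lborel \<Otimes>\<^sub>M lborel)"
  unfolding gag_quotient_def by measurable

lemma gag_density_measurable [measurable]:
  assumes [measurable]: "f \<in> borel_measurable lborel"
  shows "gag_density s f \<in> borel_measurable lborel"
  unfolding gag_density_def by measurable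

lemma nn_integral_gag_density:
  assumes f: "sq_integrable (lborel \<Otimes>\<^sub>M lborel) (gag_quotient s f)" "f \<in> borel_measurable lborel"
  shows "(\<integral>\<^sup>+x. gag_density s f x \<partial>lborel) = ennreal (sq_norm (lborel \<Otimes>\<^sub>M lborel) (gag_quotient s f))"
proof -
  note [measurable] = f(2)
  have "(\<integral>\<^sup>+x. gag_density s f x \<partial>lborel) = (\<integral>\<^sup>+z. ennreal ((norm (gag_quotient s f z))\<^sup>2) \<partial>(lborel \<Otimes>\<^sub>M lborel))"
    unfolding gag_density_def by (intro lborel.nn_integral_fst) measurable
  then show ?thesis by (simp add: nn_integral_sq_norm[OF f(1)])
qed

text \<open>
  Within a cell of side \<open>h\<close> the denominator of the Gagliardo quotient is at most
  \<open>(N h) powr (N + 2 s)\<close>, so by Cauchy-Schwarz the oscillation about the cell mean is controlled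
  by the density of the seminorm, with a factor that vanishes with \<open>h\<close>.
\<close>

lemma norm_diff_cell_mean_sq_le:
  fixes f :: "real^'n \<Rightarrow> 'b::euclidean_space"
  assumes h: "0 < h" and s: "0 < s" and f: "sq_integrable lborel f"
  shows "ennreal ((norm (f x - cell_mean h f (cell_index h x)))\<^sup>2)
    \<le> ennreal (real CARD('n) powr (real CARD('n) + 2 * s) * h powr (2 * s)) * gag_density s f x"
proof -
  let ?N = "CARD('n)" and ?Q = "cell h (cell_index h x)"
  let ?a = "real ?N + 2 * s"
  have [measurable]: "f \<in> borel_measurable lborel" using f by (simp add: sq_integrable_def)
  have Q[measurable]: "?Q \<in> sets lborel" using h by simp
  have eQ: "emeasure lborel ?Q = ennreal (h ^ ?N)" using h by (rule emeasure_cell)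
  have mQ: "measure lborel ?Q = h ^ ?N" using eQ h by (simp add: measure_def)
  have int: "set_integrable lborel ?Q f"
    using f Q by (intro sq_integrable_imp_set_integrable) (auto simp: eQ)
  have intc: "set_integrable lborel ?Q (\<lambda>y. f x)"
    unfolding set_integrable_def by (intro integrable_scaleR_left integrable_real_indicator) (use Q in \<open>auto simp: eQ\<close>)
  have const: "(LINT y:?Q|lborel. f x) = h ^ ?N *\<^sub>R f x"
    unfolding set_lebesgue_integral_def using Q by (subst integral_scaleR_left) (auto simp: mQ eQ)
  have "(LINT y:?Q|lborel. f x - f y) = h ^ ?N *\<^sub>R f x - (LINT y:?Q|lborel. f y)"
    using set_integral_diff(2)[OF intc int] by (simp only: const)
  then have "f x - cell_mean h f (cell_index h x) = (1 / h ^ ?N) *\<^sub>R (LINT y:?Q|lborel. f x - f y)"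
    using h by (simp add: cell_mean_def scaleR_diff_right)
  then have "ennreal ((norm (f x - cell_mean h f (cell_index h x)))\<^sup>2)
      = ennreal ((1 / h ^ ?N)\<^sup>2) * ennreal ((norm (LINT y:?Q|lborel. f x - f y))\<^sup>2)"
    by (simp add: power_mult_distrib power_divide flip: ennreal_mult)
  also have "\<dots> \<le> ennreal ((1 / h ^ ?N)\<^sup>2) * (ennreal (h ^ ?N) * (\<integral>\<^sup>+y\<in>?Q. ennreal ((norm (f x - f y))\<^sup>2) \<partial>lborel))"
    using ennreal_norm_set_integral_sq_le[OF Q, of "\<lambda>y. f x - f y"] by (intro mult_left_mono) (auto simp: eQ)
  also have "(\<integral>\<^sup>+y\<in>?Q. ennreal ((norm (f x - f y))\<^sup>2) \<partial>lborel)
      \<le> (\<integral>\<^sup>+y. ennreal ((real ?N * h) powr ?a) * ennreal ((norm (gag_quotient s f (x, y)))\<^sup>2) \<partial>lborel)"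
  proof (intro nn_integral_mono)
    fix y
    show "ennreal ((norm (f x - f y))\<^sup>2) * indicator ?Q y
        \<le> ennreal ((real ?N * h) powr ?a) * ennreal ((norm (gag_quotient s f (x, y)))\<^sup>2)"
    proof (cases "y \<in> ?Q \<and> x \<noteq> y")
      case True
      then have "norm (x - y) powr ?a \<le> (real ?N * h) powr ?a"
        using s norm_diff_le_of_cell[OF h, of y x] by (intro powr_mono2) auto
      moreover have "0 < norm (x - y) powr ?a" using True by simp
      ultimately have "(norm (f x - f y))\<^sup>2 \<le> (real ?N * h) powr ?a * (norm (gag_quotient s f (x, y)))\<^sup>2"
        unfolding norm_gag_quotient_sq
        by (simp add: field_simps mult_left_mono)
      then show ?thesis by (simp add: True ennreal_leI flip: ennreal_mult)
    qed auto
  qed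
  also have "\<dots> = ennreal ((real ?N * h) powr ?a) * gag_density s f x"
    unfolding gag_density_def by (intro nn_integral_cmult) measurable
  also have "ennreal ((1 / h ^ ?N)\<^sup>2) * (ennreal (h ^ ?N) * (ennreal ((real ?N * h) powr ?a) * gag_density s f x))
      = ennreal ((1 / h ^ ?N)\<^sup>2 * h ^ ?N * (real ?N * h) powr ?a) * gag_density s f x"
    using h by (simp add: ennreal_mult mult.assoc)
  also have "(1 / h ^ ?N)\<^sup>2 * h ^ ?N * (real ?N * h) powr ?a = real ?N powr ?a * h powr (2 * s)"
    using h by (simp add: powr_mult powr_add powr_realpow power2_eq_square field_simps)
  finally show ?thesis by (simp add: mult_left_mono)
qed

section \<open>The fractional Gagliardo-Nirenberg inequality\<close>

text \<open>
  At a point \<open>x\<close> with \<open>a = norm (f x) > 0\<close>, the cell size \<open>h\<close> is chosen so large that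
  mass at most \<open>M\<close> keeps the cell mean at most \<open>a / 2\<close>, that is \<open>M / h ^ N = a\<^sup>2 / 4\<close>.
  Then the oscillation about the mean is at least \<open>a / 2\<close>, and the bound on the oscillation
  becomes a pointwise estimate.
\<close>

lemma norm_powr_le_gag_density:
  fixes f :: "real^'n \<Rightarrow> 'b::euclidean_space"
  assumes s: "0 < s" and f: "sq_integrable lborel f" and M: "0 < M" "sq_norm lborel f \<le> M"
  shows "ennreal (norm (f x) powr (2 + 4 * s / real CARD('n)))
    \<le> ennreal (4 * real CARD('n) powr (real CARD('n) + 2 * s) * (4 * M) powr (2 * s / real CARD('n))) * gag_density s f x"
proof (cases "f x = 0")
  case False
  let ?N = "CARD('n)"
  define K where "K = real ?N powr (real ?N + 2 * s)"
  define a where "a = norm (f x)"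
  define h where "h = (4 * M / a\<^sup>2) powr (1 / real ?N)"
  let ?A = "cell_mean h f (cell_index h x)"
  have a: "0 < a" using False by (simp add: a_def)
  have h: "0 < h" using a M by (simp add: h_def)
  have hN: "h ^ ?N = 4 * M / a\<^sup>2"
  proof -
    have "h ^ ?N = h powr real ?N" using h by (simp add: powr_realpow)
    then show ?thesis unfolding h_def powr_powr using a M by simp
  qed
  have "(norm ?A)\<^sup>2 \<le> sq_norm lborel f / h ^ ?N" by (rule norm_cell_mean_sq_le[OF h f])
  also have "\<dots> \<le> M / h ^ ?N" using M h by (intro divide_right_mono) auto
  also have "\<dots> = (a / 2)\<^sup>2" using M a by (simp add: hN power2_eq_square)
  finally have "norm ?A \<le> a / 2" using a by (simp add: power2_le_iff_abs_le)
  then have "a / 2 \<le> norm (f x - ?A)" using norm_triangle_ineq2[of "f x" ?A] by (simp add: a_def)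
  then have "(a / 2)\<^sup>2 \<le> (norm (f x - ?A))\<^sup>2" using a by (intro power_mono) auto
  then have "ennreal ((a / 2)\<^sup>2) \<le> ennreal ((norm (f x - ?A))\<^sup>2)" by (rule ennreal_leI)
  also have "\<dots> \<le> ennreal (K * h powr (2 * s)) * gag_density s f x"
    unfolding K_def by (rule norm_diff_cell_mean_sq_le[OF h s f])
  finally have "ennreal (4 * a powr (4 * s / ?N)) * ennreal ((a / 2)\<^sup>2)
      \<le> ennreal (4 * a powr (4 * s / ?N)) * (ennreal (K * h powr (2 * s)) * gag_density s f x)"
    by (rule mult_left_mono) simp
  also have "\<dots> = ennreal (4 * a powr (4 * s / ?N) * (K * h powr (2 * s))) * gag_density s f x"
    by (simp add: ennreal_mult mult.assoc K_def)
  also have "4 * a powr (4 * s / ?N) * (K * h powr (2 * s)) = 4 * K * (4 * M) powr (2 * s / ?N)"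
  proof -
    have "h powr (2 * s) = (4 * M) powr (2 * s / ?N) / (a\<^sup>2) powr (2 * s / ?N)"
      using a M by (simp add: h_def powr_powr powr_divide)
    also have "(a\<^sup>2) powr (2 * s / ?N) = a powr (4 * s / ?N)"
    proof -
      have "(a powr 2) powr (2 * s / ?N) = a powr (4 * s / ?N)" by (simp only: powr_powr) simp
      moreover have "a powr 2 = a\<^sup>2" using a by simp
      ultimately show ?thesis by metis
    qed
    finally show ?thesis using a by simp
  qed
  also have "ennreal (4 * a powr (4 * s / ?N)) * ennreal ((a / 2)\<^sup>2) = ennreal (a powr (2 + 4 * s / ?N))"
    using a by (simp add: powr_add power2_eq_square flip: ennreal_mult)
  finally show ?thesis by (simp add: a_def K_def)
qed auto

text \<open>
  The exponent \<open>2 + 4 s / N\<close> is the one at which the power is linear in the squared seminorm, the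
  remaining homogeneity being carried by the mass. This is what makes exponents below it
  subcritical for the energy at fixed mass.
\<close>

lemma
  fixes f :: "real^'n \<Rightarrow> 'b::euclidean_space"
  assumes s: "0 < s" and f: "sq_integrable lborel f"
    and gag: "sq_integrable (lborel \<Otimes>\<^sub>M lborel) (gag_quotient s f)"
    and M: "0 < M" "sq_norm lborel f \<le> M"
  shows integrable_critical_power: "integrable lborel (\<lambda>x. norm (f x) powr (2 + 4 * s / real CARD('n)))"
    and fractional_Gagliardo_Nirenberg: "(LINT x|lborel. norm (f x) powr (2 + 4 * s / real CARD('n)))
      \<le> 4 * real CARD('n) powr (real CARD('n) + 2 * s) * (4 * M) powr (2 * s / real CARD('n))
        * sq_norm (lborel \<Otimes>\<^sub>M lborel) (gag_quotient s f)"
proof -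
  let ?q = "2 + 4 * s / real CARD('n)"
  let ?C = "4 * real CARD('n) powr (real CARD('n) + 2 * s) * (4 * M) powr (2 * s / real CARD('n))"
  have [measurable]: "f \<in> borel_measurable lborel" using f by (simp add: sq_integrable_def)
  have "(\<integral>\<^sup>+x. ennreal (norm (f x) powr ?q) \<partial>lborel) \<le> (\<integral>\<^sup>+x. ennreal ?C * gag_density s f x \<partial>lborel)"
    by (intro nn_integral_mono norm_powr_le_gag_density s f M)
  also have "\<dots> = ennreal ?C * (\<integral>\<^sup>+x. gag_density s f x \<partial>lborel)"
    by (intro nn_integral_cmult) measurable
  also have "\<dots> = ennreal (?C * sq_norm (lborel \<Otimes>\<^sub>M lborel) (gag_quotient s f))"
    by (subst nn_integral_gag_density[OF gag]) (auto simp: ennreal_mult)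
  finally have le: "(\<integral>\<^sup>+x. ennreal (norm (f x) powr ?q) \<partial>lborel)
      \<le> ennreal (?C * sq_norm (lborel \<Otimes>\<^sub>M lborel) (gag_quotient s f))" .
  have "(\<integral>\<^sup>+x. ennreal (norm (f x) powr ?q) \<partial>lborel) < \<infinity>"
    by (rule le_less_trans[OF le]) simp
  then show int: "integrable lborel (\<lambda>x. norm (f x) powr ?q)"
    by (simp add: integrable_iff_bounded)
  show "(LINT x|lborel. norm (f x) powr ?q) \<le> ?C * sq_norm (lborel \<Otimes>\<^sub>M lborel) (gag_quotient s f)"
  proof (rule ennreal_le_iff[THEN iffD1])
    show "0 \<le> ?C * sq_norm (lborel \<Otimes>\<^sub>M lborel) (gag_quotient s f)"
      by (intro mult_nonneg_nonneg powr_ge_zero sq_norm_nonneg) simp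
    show "ennreal (LINT x|lborel. norm (f x) powr ?q) \<le> ennreal (?C * sq_norm (lborel \<Otimes>\<^sub>M lborel) (gag_quotient s f))"
      using le nn_integral_eq_integral[OF int] by simp
  qed
qed

section \<open>Subcritical powers\<close>

lemma powr_interpolation:
  fixes p q d :: real
  assumes p: "2 < p" "p < q" and d: "0 < d"
  obtains K where "0 \<le> K" "\<And>a. 0 \<le> a \<Longrightarrow> a powr p \<le> d * a powr q + K * a\<^sup>2"
proof
  \<comment> \<open>Above \<open>t\<close> the factor \<open>a powr (p - q)\<close> is at most \<open>d\<close>; below \<open>t\<close> the quadratic term dominates.\<close>
  define t where "t = d powr (- 1 / (q - p))"
  have t: "0 < t" using d by (simp add: t_def)
  show "0 \<le> t powr (p - 2)" by simp
  fix a :: real assume a: "0 \<le> a"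
  show "a powr p \<le> d * a powr q + t powr (p - 2) * a\<^sup>2"
  proof (cases "t \<le> a")
    case True
    have "a powr p = a powr q * a powr (- (q - p))" using True t by (simp flip: powr_add)
    also have "\<dots> \<le> a powr q * t powr (- (q - p))"
      using True t p by (intro mult_left_mono powr_mono2') auto
    also have "t powr (- (q - p)) = d"
    proof -
      have "- 1 / (q - p) * (- (q - p)) = 1" using p by (simp add: field_simps)
      then show ?thesis using d by (simp only: t_def powr_powr powr_one)
    qed
    finally show ?thesis by (simp add: mult.commute add_increasing2)
  next
    case False
    show ?thesis
    proof (cases "a = 0")
      case False
      have "a powr p = a powr (p - 2) * a powr 2" by (simp flip: powr_add)
      also have "a powr 2 = a\<^sup>2" using a False by simp
      also have "a powr (p - 2) * a\<^sup>2 \<le> t powr (p - 2) * a\<^sup>2"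
        using \<open>\<not> t \<le> a\<close> a p by (intro mult_right_mono powr_mono2) auto
      finally show ?thesis using d by (simp add: add_increasing)
    qed auto
  qed
qed

text \<open>
  Two nearly equal values have nearly equal powers; otherwise the larger one is dominated by the
  difference. Interpolation between the exponents 2 and \<open>q\<close> makes the error terms integrable.
\<close>

lemma powr_diff_interpolation:
  fixes p q d :: real
  assumes p: "2 < p" "p < q" and d: "0 < d"
  obtains K where "0 \<le> K"
    "\<And>a b. 0 \<le> a \<Longrightarrow> 0 \<le> b \<Longrightarrow> \<bar>a powr p - b powr p\<bar> \<le> d * (a powr q + b powr q + a\<^sup>2 + b\<^sup>2) + K * (a - b)\<^sup>2"
proof -
  obtain K1 where K1: "0 \<le> K1" "\<And>a. 0 \<le> a \<Longrightarrow> a powr p \<le> d * a powr q + K1 * a\<^sup>2"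
    using powr_interpolation[OF p d] by blast
  obtain K2 where K2: "0 \<le> K2" "\<And>a. 0 \<le> a \<Longrightarrow> a powr p \<le> 1 * a powr q + K2 * a\<^sup>2"
    using powr_interpolation[OF p, of 1] by auto
  \<comment> \<open>When the ratio of the values is at least \<open>t\<close>, their powers differ by at most the fraction \<open>e\<close> of the larger one.\<close>
  define e where "e = min (1/2) (d / (1 + K2))"
  have e: "0 < e" "e < 1" using d K2(1) by (auto simp: e_def)
  have "e \<le> d / (1 + K2)" by (simp add: e_def)
  then have e_le: "e * (1 + K2) \<le> d" using K2(1) by (simp add: pos_le_divide_eq)
  define t where "t = (1 - e) powr (1 / p)"
  have t: "0 < t" "t < 1" using e p powr_less_mono2[of "1/p" "1-e" 1] by (auto simp: t_def)
  have tp: "t powr p = 1 - e" using e p by (simp add: t_def powr_powr)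
  define K where "K = K1 / (1 - t)\<^sup>2"
  have ordered: "\<bar>a powr p - b powr p\<bar> \<le> d * (a powr q + b powr q + a\<^sup>2 + b\<^sup>2) + K * (a - b)\<^sup>2"
    if ab: "0 \<le> b" "b \<le> a" for a b
  proof -
    have "b powr p \<le> a powr p" using ab p by (intro powr_mono2) auto
    moreover have "a powr p - b powr p \<le> d * (a powr q + a\<^sup>2) + K * (a - b)\<^sup>2"
    proof (cases "t * a \<le> b")
      case True
      then have "(t * a) powr p \<le> b powr p" using ab t p by (intro powr_mono2) auto
      then have "a powr p - b powr p \<le> e * a powr p"
        using ab t by (simp add: powr_mult tp algebra_simps)
      also have "\<dots> \<le> e * (a powr q + K2 * a\<^sup>2)" using K2(2)[of a] ab e by (intro mult_left_mono) auto
      also have "\<dots> \<le> (e * (1 + K2)) * (a powr q + a\<^sup>2)"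
        using e K2 by (simp add: algebra_simps)
      also have "\<dots> \<le> d * (a powr q + a\<^sup>2)" using e_le by (intro mult_right_mono) auto
      finally show ?thesis using K1 by (simp add: K_def add_increasing2)
    next
      case False
      then have "(1 - t) * a \<le> a - b" by (simp add: algebra_simps)
      then have "((1 - t) * a)\<^sup>2 \<le> (a - b)\<^sup>2" using t ab by (intro power_mono) auto
      then have "a\<^sup>2 \<le> (a - b)\<^sup>2 / (1 - t)\<^sup>2"
        unfolding power_mult_distrib using t by (simp add: pos_le_divide_eq mult.commute)
      from mult_left_mono[OF this K1(1)] have "K1 * a\<^sup>2 \<le> K * (a - b)\<^sup>2" by (simp add: K_def)
      moreover have "a powr p \<le> d * a powr q + K1 * a\<^sup>2" using K1(2) ab by simp
      moreover have "0 \<le> b powr p" "0 \<le> d * a\<^sup>2" using d by auto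
      ultimately show ?thesis unfolding distrib_left by linarith
    qed
    moreover have "0 \<le> d * (b powr q + b\<^sup>2)" using d by auto
    ultimately show ?thesis by (simp add: algebra_simps)
  qed
  show ?thesis
  proof (rule that[of K])
    show "0 \<le> K" using K1 by (simp add: K_def)
    fix a b :: real assume "0 \<le> a" "0 \<le> b"
    then show "\<bar>a powr p - b powr p\<bar> \<le> d * (a powr q + b powr q + a\<^sup>2 + b\<^sup>2) + K * (a - b)\<^sup>2"
      using ordered[of b a] ordered[of a b]
      by (cases "b \<le> a") (auto simp: abs_minus_commute power2_commute add_ac)
  qed
qed

lemma integrable_powr_between:
  fixes f :: "'a \<Rightarrow> 'b::euclidean_space"
  assumes p: "2 < p" "p < q" and f: "sq_integrable M f" and fq: "integrable M (\<lambda>x. norm (f x) powr q)"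
  shows "integrable M (\<lambda>x. norm (f x) powr p)"
proof -
  obtain K where K: "\<And>a. 0 \<le> a \<Longrightarrow> a powr p \<le> 1 * a powr q + K * a\<^sup>2"
    using powr_interpolation[OF p, of 1] by auto
  have [measurable]: "f \<in> borel_measurable M" using f by (simp add: sq_integrable_def)
  show ?thesis
  proof (rule Bochner_Integration.integrable_bound)
    show "integrable M (\<lambda>x. 1 * norm (f x) powr q + K * (norm (f x))\<^sup>2)"
      using f fq by (auto simp: sq_integrable_def)
    show "AE x in M. norm (norm (f x) powr p) \<le> norm (1 * norm (f x) powr q + K * (norm (f x))\<^sup>2)"
    proof (rule AE_I2)
      fix x
      have "norm (norm (f x) powr p) \<le> 1 * norm (f x) powr q + K * (norm (f x))\<^sup>2"
        using K[of "norm (f x)"] by simp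
      also have "\<dots> \<le> norm (1 * norm (f x) powr q + K * (norm (f x))\<^sup>2)"
        unfolding real_norm_def by (rule abs_ge_self)
      finally show "norm (norm (f x) powr p) \<le> norm (1 * norm (f x) powr q + K * (norm (f x))\<^sup>2)" .
    qed
  qed measurable
qed

text \<open>
  Below the exponent \<open>q\<close>, mean-square convergence is enough for the power to converge, since
  boundedness of the \<open>q\<close>-th powers excludes concentration.
\<close>

lemma integral_powr_tendsto:
  fixes f :: "nat \<Rightarrow> 'a \<Rightarrow> 'b::euclidean_space"
  assumes p: "2 < p" "p < q"
    and f: "\<And>n. sq_integrable M (f n)" and fq: "\<And>n. integrable M (\<lambda>x. norm (f n x) powr q)"
    and g: "sq_integrable M g" and gq: "integrable M (\<lambda>x. norm (g x) powr q)"
    and B: "\<And>n. sq_norm M (f n) \<le> B" "\<And>n. (LINT x|M. norm (f n x) powr q) \<le> B"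
    and lim: "(\<lambda>n. sq_norm M (\<lambda>x. f n x - g x)) \<longlonglongrightarrow> 0"
  shows "(\<lambda>n. LINT x|M. norm (f n x) powr p) \<longlonglongrightarrow> (LINT x|M. norm (g x) powr p)"
proof (rule tendsto_if_dominated_up_to_epsilon[OF lim])
  fix e :: real assume e: "0 < e"
  define W where "W = 2 * B + sq_norm M g + (LINT x|M. norm (g x) powr q)"
  have W: "0 \<le> W" using order_trans[OF sq_norm_nonneg B(1)] by (auto simp: W_def)
  define d where "d = e / (W + 1)"
  have d: "0 < d" "d * W \<le> e" using e W by (auto simp: d_def field_simps)
  obtain K where K: "0 \<le> K" "\<And>a b. 0 \<le> a \<Longrightarrow> 0 \<le> b \<Longrightarrow>
      \<bar>a powr p - b powr p\<bar> \<le> d * (a powr q + b powr q + a\<^sup>2 + b\<^sup>2) + K * (a - b)\<^sup>2"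
    using powr_diff_interpolation[OF p d(1)] by blast
  have "\<bar>(LINT x|M. norm (f n x) powr p) - (LINT x|M. norm (g x) powr p)\<bar>
      \<le> e + K * sq_norm M (\<lambda>x. f n x - g x)" for n
  proof -
    note i = f[of n, unfolded sq_integrable_def] g[unfolded sq_integrable_def]
      sq_integrable_diff[OF f[of n] g, unfolded sq_integrable_def] fq[of n] gq
      integrable_powr_between[OF p f fq, of n] integrable_powr_between[OF p g gq]
    have pointwise: "\<bar>norm (f n x) powr p - norm (g x) powr p\<bar>
      \<le> d * (norm (f n x) powr q + norm (g x) powr q + (norm (f n x))\<^sup>2 + (norm (g x))\<^sup>2) + K * (norm (f n x - g x))\<^sup>2" for x
    proof -
      have "(norm (f n x) - norm (g x))\<^sup>2 \<le> (norm (f n x - g x))\<^sup>2"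
        using norm_triangle_ineq3[of "f n x" "g x"] by (intro abs_le_square_iff[THEN iffD1]) auto
      then have "K * (norm (f n x) - norm (g x))\<^sup>2 \<le> K * (norm (f n x - g x))\<^sup>2"
        using K(1) by (rule mult_left_mono)
      with K(2)[of "norm (f n x)" "norm (g x)"] show ?thesis by simp
    qed
    have "\<bar>(LINT x|M. norm (f n x) powr p) - (LINT x|M. norm (g x) powr p)\<bar>
        = \<bar>LINT x|M. norm (f n x) powr p - norm (g x) powr p\<bar>"
      using i by simp
    also have "\<dots> \<le> (LINT x|M. \<bar>norm (f n x) powr p - norm (g x) powr p\<bar>)"
      by (rule integral_abs_bound)
    also have "\<dots> \<le> (LINT x|M. d * (norm (f n x) powr q + norm (g x) powr q + (norm (f n x))\<^sup>2 + (norm (g x))\<^sup>2) + K * (norm (f n x - g x))\<^sup>2)"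
      using i by (intro integral_mono pointwise) auto
    also have "\<dots> = d * ((LINT x|M. norm (f n x) powr q) + (LINT x|M. norm (g x) powr q) + sq_norm M (f n) + sq_norm M g) + K * sq_norm M (\<lambda>x. f n x - g x)"
      using i by (simp add: sq_norm_def)
    also have "\<dots> \<le> d * W + K * sq_norm M (\<lambda>x. f n x - g x)"
      using B[of n] d by (intro add_right_mono mult_left_mono) (auto simp: W_def)
    finally show ?thesis using d by simp
  qed
  then show "\<exists>K. \<forall>n. \<bar>(LINT x|M. norm (f n x) powr p) - (LINT x|M. norm (g x) powr p)\<bar>
      \<le> e + K * sq_norm M (\<lambda>x. f n x - g x)" by blast
qed

section \<open>Compactness in the mean square\<close>

lemma measurable_cell_index:
  assumes "0 < h"
  shows "cell_index h \<in> measurable (borel :: (real^'n) measure) (count_space UNIV)"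
proof -
  have "cell_index h -` {m} \<inter> space borel = cell h m" for m :: "'n \<Rightarrow> int"
    by (auto simp: cell_def)
  then show ?thesis
    by (simp add: measurable_count_space_eq_countable sets_cell[OF assms])
qed

text \<open>
  The limit of the cell means, cut off outside a large ball, is almost a limit of the sequence:
  the tails are small by the weight, the oscillations in the cells by the Gagliardo seminorm,
  and on the ball the cell means converge boundedly.
\<close>

lemma eventually_sq_norm_diff_cell_limit_less:
  fixes F :: "nat \<Rightarrow> real^'n \<Rightarrow> 'b::euclidean_space"
  assumes s: "0 < s" and F: "\<And>n. sq_integrable lborel (F n)" "\<And>n. sq_norm lborel (F n) \<le> B"
    and gag: "\<And>n. sq_integrable (lborel \<Otimes>\<^sub>M lborel) (gag_quotient s (F n))"
      "\<And>n. sq_norm (lborel \<Otimes>\<^sub>M lborel) (gag_quotient s (F n)) \<le> B"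
    and weight: "\<And>n. sq_integrable lborel (\<lambda>x. norm x *\<^sub>R F n x)"
      "\<And>n. sq_norm lborel (\<lambda>x. norm x *\<^sub>R F n x) \<le> B"
    and h: "0 < h" and R: "0 < R"
    and l: "\<And>m. (\<lambda>n. cell_mean h (F n) m) \<longlonglongrightarrow> l m"
    and e: "B / R\<^sup>2 + 2 * (real CARD('n) powr (real CARD('n) + 2 * s) * h powr (2 * s)) * B < e"
  defines "g \<equiv> \<lambda>x. indicator (cball 0 R) x *\<^sub>R l (cell_index h x)"
  shows "\<forall>\<^sub>F n in sequentially. sq_integrable lborel (\<lambda>x. F n x - g x) \<and> sq_norm lborel (\<lambda>x. F n x - g x) < e"
proof -
  let ?K = "real CARD('n) powr (real CARD('n) + 2 * s) * h powr (2 * s)"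
  define mean where "mean n x = cell_mean h (F n) (cell_index h x)" for n x
  define L where "L x = l (cell_index h x)" for x
  have g_eq: "g x = indicator (cball 0 R) x *\<^sub>R L x" for x by (simp add: g_def L_def)
  have [measurable]: "F n \<in> borel_measurable lborel" for n using F by (simp add: sq_integrable_def)
  have idx: "(\<lambda>x::real^'n. \<phi> (cell_index h x)) \<in> borel_measurable borel" for \<phi> :: "('n \<Rightarrow> int) \<Rightarrow> 'b"
    by (rule measurable_compose[OF measurable_cell_index[OF h]]) simp
  have [measurable]: "mean n \<in> borel_measurable lborel" "L \<in> borel_measurable lborel" for n
    unfolding mean_def L_def by (simp_all add: idx)
  have [measurable]: "cball 0 R \<in> sets (borel :: (real^'n) measure)" by simp
  have [measurable]: "g \<in> borel_measurable lborel" unfolding g_eq[abs_def] by measurable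
  have B: "0 \<le> B" using order_trans[OF sq_norm_nonneg F(2)] .
  define T where "T n = (\<integral>\<^sup>+x. ennreal ((norm (mean n x - L x))\<^sup>2) * indicator (cball 0 R) x \<partial>lborel)" for n
  have mean_bound: "(norm (cell_mean h (F n) m))\<^sup>2 \<le> B / h ^ CARD('n)" for n m
    using norm_cell_mean_sq_le[OF h F(1)[of n], of m] F(2)[of n] h
    by (meson divide_right_mono order_trans zero_le_power less_imp_le)
  have l_bound: "(norm (l m))\<^sup>2 \<le> B / h ^ CARD('n)" for m
    by (rule LIMSEQ_le_const2[OF tendsto_power[OF tendsto_norm[OF l]]]) (use mean_bound in auto)
  have diff_bound: "(norm (mean n x - L x))\<^sup>2 \<le> 4 * (B / h ^ CARD('n))" for n x
    using norm_add_sq_le(2)[of "mean n x" "L x"] mean_bound[of n "cell_index h x"] l_bound[of "cell_index h x"]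
    unfolding mean_def L_def by linarith
  have "T \<longlonglongrightarrow> nn_integral lborel (\<lambda>x::real^'n. 0)"
    unfolding T_def
  proof (rule nn_integral_dominated_convergence[where w="\<lambda>x. ennreal (4 * (B / h ^ CARD('n))) * indicator (cball 0 R) x"])
    show "nn_integral lborel (\<lambda>x::real^'n. ennreal (4 * (B / h ^ CARD('n))) * indicator (cball 0 R) x) < \<infinity>"
      using emeasure_lborel_cball_finite[of "0 :: real^'n" R]
      by (subst nn_integral_cmult) (auto simp: ennreal_mult_less_top)
    show "AE x in lborel. ennreal ((norm (mean n x - L x))\<^sup>2) * indicator (cball 0 R) x
        \<le> ennreal (4 * (B / h ^ CARD('n))) * indicator (cball 0 R) x" for n
      using diff_bound by (intro AE_I2 mult_right_mono ennreal_leI) auto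
    show "AE x in lborel. (\<lambda>n. ennreal ((norm (mean n x - L x))\<^sup>2) * indicator (cball 0 R) x) \<longlonglongrightarrow> 0"
    proof (rule AE_I2)
      fix x :: "real^'n"
      have "(\<lambda>n. ennreal ((norm (mean n x - L x))\<^sup>2)) \<longlonglongrightarrow> ennreal ((norm (L x - L x))\<^sup>2)"
        unfolding mean_def L_def
        by (intro tendsto_ennrealI tendsto_power tendsto_norm tendsto_diff l tendsto_const)
      then have "(\<lambda>n. ennreal ((norm (mean n x - L x))\<^sup>2)) \<longlonglongrightarrow> 0" by simp
      then show "(\<lambda>n. ennreal ((norm (mean n x - L x))\<^sup>2) * indicator (cball 0 R) x) \<longlonglongrightarrow> 0"
        by (auto simp: indicator_def)
    qed
  qed measurable
  then have T0: "T \<longlonglongrightarrow> 0" by simp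
  have bound: "(\<integral>\<^sup>+x. ennreal ((norm (F n x - g x))\<^sup>2) \<partial>lborel) \<le> ennreal (B / R\<^sup>2 + 2 * ?K * B) + 2 * T n" for n
  proof -
    let ?t1 = "\<lambda>x. ennreal ((norm (norm x *\<^sub>R F n x))\<^sup>2)"
    let ?t2 = "\<lambda>x. ennreal ((norm (F n x - mean n x))\<^sup>2)"
    let ?t3 = "\<lambda>x. ennreal ((norm (mean n x - L x))\<^sup>2) * indicator (cball 0 R) x"
    have "ennreal ((norm (F n x - g x))\<^sup>2) \<le> ennreal (1 / R\<^sup>2) * ?t1 x + 2 * ?t2 x + 2 * ?t3 x" for x
    proof (cases "x \<in> cball 0 R")
      case True
      have "ennreal ((norm (F n x - g x))\<^sup>2) \<le> ennreal (2 * (norm (F n x - mean n x))\<^sup>2 + 2 * (norm (mean n x - L x))\<^sup>2)"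
        using norm_add_sq_le(1)[of "F n x - mean n x" "mean n x - L x"] True
        by (intro ennreal_leI) (simp add: g_eq)
      also have "\<dots> = 2 * ?t2 x + 2 * ?t3 x" using True by (simp add: ennreal_mult)
      also have "\<dots> \<le> ennreal (1 / R\<^sup>2) * ?t1 x + 2 * ?t2 x + 2 * ?t3 x" by (simp add: add.assoc)
      finally show ?thesis .
    next
      case False
      then have "R\<^sup>2 \<le> (norm x)\<^sup>2" using R by (intro power_mono) auto
      then have "1 * (norm (F n x))\<^sup>2 \<le> (1 / R\<^sup>2 * (norm x)\<^sup>2) * (norm (F n x))\<^sup>2"
        using R by (intro mult_right_mono) (auto simp: field_simps)
      then have "ennreal ((norm (F n x - g x))\<^sup>2) \<le> ennreal (1 / R\<^sup>2 * (norm (norm x *\<^sub>R F n x))\<^sup>2)"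
        using False by (intro ennreal_leI) (simp add: g_eq power_mult_distrib)
      also have "\<dots> = ennreal (1 / R\<^sup>2) * ?t1 x" by (rule ennreal_mult) auto
      finally show ?thesis by (simp add: add.assoc add_increasing2)
    qed
    then have "(\<integral>\<^sup>+x. ennreal ((norm (F n x - g x))\<^sup>2) \<partial>lborel)
        \<le> (\<integral>\<^sup>+x. ennreal (1 / R\<^sup>2) * ?t1 x + 2 * ?t2 x + 2 * ?t3 x \<partial>lborel)"
      by (intro nn_integral_mono)
    also have "\<dots> = ennreal (1 / R\<^sup>2) * (\<integral>\<^sup>+x. ?t1 x \<partial>lborel) + 2 * (\<integral>\<^sup>+x. ?t2 x \<partial>lborel) + 2 * T n"
      unfolding T_def by (simp add: nn_integral_add nn_integral_cmult)
    also have "(\<integral>\<^sup>+x. ?t1 x \<partial>lborel) \<le> ennreal B"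
      using weight(2)[of n] by (simp only: nn_integral_sq_norm[OF weight(1)]) (rule ennreal_leI)
    also have "(\<integral>\<^sup>+x. ?t2 x \<partial>lborel) \<le> (\<integral>\<^sup>+x. ennreal ?K * gag_density s (F n) x \<partial>lborel)"
      unfolding mean_def by (intro nn_integral_mono norm_diff_cell_mean_sq_le h s F)
    also have "\<dots> = ennreal ?K * ennreal (sq_norm (lborel \<Otimes>\<^sub>M lborel) (gag_quotient s (F n)))"
      by (simp add: nn_integral_cmult nn_integral_gag_density[OF gag(1)])
    also have "\<dots> \<le> ennreal ?K * ennreal B" using gag(2)[of n] by (intro mult_left_mono ennreal_leI) auto
    also have "ennreal (1 / R\<^sup>2) * ennreal B + 2 * (ennreal ?K * ennreal B) + 2 * T n
        = ennreal (B / R\<^sup>2 + 2 * ?K * B) + 2 * T n"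
    proof -
      have "ennreal (1 / R\<^sup>2) * ennreal B = ennreal (B / R\<^sup>2)"
        using B by (subst ennreal_mult[symmetric]) auto
      moreover have "2 * (ennreal ?K * ennreal B) = ennreal (2 * ?K * B)"
        using B by (simp add: ennreal_mult mult.assoc)
      moreover have "ennreal (B / R\<^sup>2 + 2 * ?K * B) = ennreal (B / R\<^sup>2) + ennreal (2 * ?K * B)"
        using B by (intro ennreal_plus) auto
      ultimately show ?thesis by simp
    qed
    finally show ?thesis by (simp add: mult_left_mono add_mono)
  qed
  define d where "d = e - (B / R\<^sup>2 + 2 * ?K * B)"
  have d: "0 < d" using e by (simp add: d_def)
  have "\<forall>\<^sub>F n in sequentially. T n < ennreal (d / 4)"
    using d by (intro order_tendstoD(2)[OF T0]) auto
  then show ?thesis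
  proof eventually_elim
    case (elim n)
    have c0: "0 \<le> B / R\<^sup>2 + 2 * ?K * B" using B by simp
    have "(\<integral>\<^sup>+x. ennreal ((norm (F n x - g x))\<^sup>2) \<partial>lborel) \<le> ennreal (B / R\<^sup>2 + 2 * ?K * B) + 2 * ennreal (d / 4)"
      using elim by (intro order_trans[OF bound] add_left_mono mult_left_mono) auto
    also have "\<dots> = ennreal (B / R\<^sup>2 + 2 * ?K * B + d / 2)"
    proof -
      have "2 * ennreal (d / 4) = ennreal (2 * (d / 4))" using d by (subst ennreal_mult) auto
      then show ?thesis using ennreal_plus[OF c0, of "d / 2"] d by simp
    qed
    finally have le: "(\<integral>\<^sup>+x. ennreal ((norm (F n x - g x))\<^sup>2) \<partial>lborel) \<le> ennreal (B / R\<^sup>2 + 2 * ?K * B + d / 2)" .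
    have "sq_norm lborel (\<lambda>x. F n x - g x) \<le> B / R\<^sup>2 + 2 * ?K * B + d / 2"
      using sq_integrable_of_nn_integral_le(2)[OF _ le] c0 d by simp
    also have "\<dots> < e" using d e unfolding d_def by argo
    finally have "sq_norm lborel (\<lambda>x. F n x - g x) < e" .
    then show ?case
      using sq_integrable_of_nn_integral_le(1)[OF _ le] by simp
  qed
qed

text \<open>
  Cell means live on a countable grid, so a diagonal subsequence makes all of them converge for
  all sides \<open>1 / Suc k\<close>. By the preceding estimate this subsequence is Cauchy.
\<close>

theorem compact_embedding:
  fixes f :: "nat \<Rightarrow> real^'n \<Rightarrow> 'b::euclidean_space"
  assumes s: "0 < s" and f: "\<And>n. sq_integrable lborel (f n)" "\<And>n. sq_norm lborel (f n) \<le> B"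
    and gag: "\<And>n. sq_integrable (lborel \<Otimes>\<^sub>M lborel) (gag_quotient s (f n))"
      "\<And>n. sq_norm (lborel \<Otimes>\<^sub>M lborel) (gag_quotient s (f n)) \<le> B"
    and weight: "\<And>n. sq_integrable lborel (\<lambda>x. norm x *\<^sub>R f n x)"
      "\<And>n. sq_norm lborel (\<lambda>x. norm x *\<^sub>R f n x) \<le> B"
  obtains r g where "strict_mono r" "sq_integrable lborel g"
    "AE x in lborel. (\<lambda>n. f (r n) x) \<longlonglongrightarrow> g x" "(\<lambda>n. sq_norm lborel (\<lambda>x. f (r n) x - g x)) \<longlonglongrightarrow> 0"
proof -
  let ?N = "CARD('n)"
  define h where "h k = 1 / real (Suc k)" for k
  have h: "0 < h k" for k by (simp add: h_def)
  have B: "0 \<le> B" using order_trans[OF sq_norm_nonneg f(2)] .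
  \<comment> \<open>The factor makes the means bounded by \<open>sqrt B\<close>, uniformly in the side of the cell.\<close>
  define A where "A n km = sqrt (h (fst km) ^ ?N) *\<^sub>R cell_mean (h (fst km)) (f n) (snd km)" for n and km :: "nat \<times> ('n \<Rightarrow> int)"
  have A_le: "norm (A n km) \<le> sqrt B" for n km
  proof (rule real_le_rsqrt)
    have "(norm (A n km))\<^sup>2 = h (fst km) ^ ?N * (norm (cell_mean (h (fst km)) (f n) (snd km)))\<^sup>2"
      using h[of "fst km"] by (simp add: A_def power_mult_distrib)
    also have "\<dots> \<le> h (fst km) ^ ?N * (sq_norm lborel (f n) / h (fst km) ^ ?N)"
      using h[of "fst km"] by (intro mult_left_mono norm_cell_mean_sq_le f) auto
    also have "\<dots> \<le> B" using h[of "fst km"] f(2)[of n] by simp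
    finally show "(norm (A n km))\<^sup>2 \<le> B" .
  qed
  obtain r where r: "strict_mono (r :: nat \<Rightarrow> nat)" "\<And>km. km \<in> UNIV \<Longrightarrow> \<exists>l. (\<lambda>n. A (r n) km) \<longlonglongrightarrow> l"
    using function_convergent_subsequence[of UNIV A "sqrt B"] A_le by (metis countableI_type)
  have "\<exists>l. (\<lambda>n. cell_mean (h k) (f (r n)) m) \<longlonglongrightarrow> l" for k m
  proof -
    obtain l where "(\<lambda>n. A (r n) (k, m)) \<longlonglongrightarrow> l" using r(2) by blast
    then have "(\<lambda>n. (1 / sqrt (h k ^ ?N)) *\<^sub>R A (r n) (k, m)) \<longlonglongrightarrow> (1 / sqrt (h k ^ ?N)) *\<^sub>R l"
      by (intro tendsto_intros)
    moreover have "(1 / sqrt (h k ^ ?N)) *\<^sub>R A (r n) (k, m) = cell_mean (h k) (f (r n)) m" for n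
      using h[of k] by (simp add: A_def)
    ultimately show ?thesis by auto
  qed
  then obtain l where l: "\<And>k m. (\<lambda>n. cell_mean (h k) (f (r n)) m) \<longlonglongrightarrow> l k m" by metis
  have Cauchy: "\<exists>n0. \<forall>m\<ge>n0. \<forall>n\<ge>n0. sq_norm lborel (\<lambda>x. f (r m) x - f (r n) x) < e" if e: "0 < e" for e
  proof -
    \<comment> \<open>\<open>k\<close> and \<open>R\<close> bring the oscillation term and the tail term below \<open>e / 8\<close> each.\<close>
    define K where "K = real ?N powr (real ?N + 2 * s)"
    have "(\<lambda>k. h k powr (2 * s)) \<longlonglongrightarrow> 0"
      unfolding h_def using s
      by (intro tendsto_zero_powrI[OF lim_1_over_real_power[of 1, simplified, THEN LIMSEQ_Suc] tendsto_const]) auto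
    then have "(\<lambda>k. 2 * (K * h k powr (2 * s)) * B) \<longlonglongrightarrow> 2 * (K * 0) * B" by (intro tendsto_intros)
    then have "\<forall>\<^sub>F k in sequentially. 2 * (K * h k powr (2 * s)) * B < e / 8"
      using e by (intro order_tendstoD(2)) auto
    then obtain k where k: "2 * (K * h k powr (2 * s)) * B < e / 8" by (auto simp: eventually_sequentially)
    define R where "R = sqrt (8 * (B + 1) / e)"
    have R: "0 < R" "B / R\<^sup>2 < e / 8" using e B by (auto simp: R_def field_simps)
    define g where "g x = indicator (cball 0 R) x *\<^sub>R l k (cell_index (h k) x)" for x
    have "B / R\<^sup>2 + 2 * (K * h k powr (2 * s)) * B < e / 4" using k R(2) by linarith
    then have "\<forall>\<^sub>F n in sequentially. sq_integrable lborel (\<lambda>x. f (r n) x - g x) \<and> sq_norm lborel (\<lambda>x. f (r n) x - g x) < e / 4"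
      unfolding g_def K_def
      by (rule eventually_sq_norm_diff_cell_limit_less[OF s f(1) f(2) gag(1) gag(2) weight(1) weight(2) h R(1) l])
    then obtain n0 where n0: "\<And>n. n \<ge> n0 \<Longrightarrow> sq_integrable lborel (\<lambda>x. f (r n) x - g x) \<and> sq_norm lborel (\<lambda>x. f (r n) x - g x) < e / 4"
      by (auto simp: eventually_sequentially)
    have "sq_norm lborel (\<lambda>x. f (r m) x - f (r n) x) < e" if "m \<ge> n0" "n \<ge> n0" for m n
      using sq_norm_diff_le[of lborel "\<lambda>x. f (r m) x - g x" "\<lambda>x. f (r n) x - g x"] n0[OF that(1)] n0[OF that(2)] by simp
    then show ?thesis by blast
  qed
  obtain r' g where r': "strict_mono r'" "sq_integrable lborel g" "AE x in lborel. (\<lambda>n. f (r (r' n)) x) \<longlonglongrightarrow> g x"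
    "(\<lambda>n. sq_norm lborel (\<lambda>x. f (r (r' n)) x - g x)) \<longlonglongrightarrow> 0"
    using sq_norm_Cauchy_AE_subsequence[of lborel "\<lambda>n. f (r n)", OF f(1) Cauchy] by blast
  then show ?thesis
    using that[of "r \<circ> r'" g] r(1) by (simp add: strict_mono_o)
qed

section \<open>A function of finite energy\<close>

text \<open>
  Lipschitz functions of compact support have a finite seminorm because the kernel below is
  integrable: near the origin the numerator gains \<open>2 > 2 s\<close> powers, at infinity \<open>2 s > 0\<close> powers
  remain. Both are seen on dyadic shells, where the integral is a geometric series.
\<close>

definition cutoff_kernel :: "real \<Rightarrow> real ^ 'n \<Rightarrow> real" where
  "cutoff_kernel s z = min 1 ((norm z)\<^sup>2) / norm z powr (real CARD('n) + 2 * s)"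

lemma two_powr_power: "((2::real) powr x) ^ n = 2 powr (x * real n)"
  by (simp add: powr_power mult.commute)

lemma cutoff_kernel_le_dyadic:
  fixes z :: "real^'n"
  assumes s: "0 < s"
  defines "p \<equiv> real CARD('n) + 2 * s"
  obtains j :: nat where
    "cutoff_kernel s z \<le> (2 powr (- real j))\<^sup>2 * 2 powr ((real j + 1) * p) * indicator (cball 0 (2 powr (- real j))) z
      + 2 powr (- real j * p) * indicator (cball 0 (2 powr (real j + 1))) z"
proof (cases "z = 0")
  case True
  then show ?thesis using that[of 0] by (simp add: cutoff_kernel_def)
next
  case False
  let ?t = "norm z"
  have t: "0 < ?t" using False by simp
  have p: "0 < p" using s by (simp add: p_def add_nonneg_pos)
  \<comment> \<open>\<open>j\<close> is the index of the dyadic shell of \<open>z\<close>, counted inwards or outwards from the unit sphere.\<close>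
  define L where "L = \<bar>log 2 ?t\<bar>"
  define j where "j = nat \<lfloor>L\<rfloor>"
  have "real j = of_int \<lfloor>L\<rfloor>" by (simp add: j_def L_def)
  then have j: "real j \<le> L" "L \<le> real j + 1" by linarith+
  have k: "cutoff_kernel s z = min 1 (?t\<^sup>2) / ?t powr p" by (simp add: cutoff_kernel_def p_def)
  show ?thesis
  proof (cases "?t \<le> 1")
    case True
    then have "log 2 ?t \<le> 0" using t by simp
    then have "?t = 2 powr (- L)" using t by (simp add: L_def)
    then have lo: "2 powr (- (real j + 1)) \<le> ?t" and hi: "?t \<le> 2 powr (- real j)"
      using j by simp_all
    have "min 1 (?t\<^sup>2) \<le> (2 powr (- real j))\<^sup>2"
      using hi by (intro min.coboundedI2 power_mono) auto
    moreover have "(2 powr (- (real j + 1))) powr p \<le> ?t powr p"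
      using lo p by (intro powr_mono2) auto
    ultimately have "cutoff_kernel s z \<le> (2 powr (- real j))\<^sup>2 / (2 powr (- (real j + 1))) powr p"
      unfolding k using t by (intro frac_le) auto
    also have "\<dots> = (2 powr (- real j))\<^sup>2 * 2 powr ((real j + 1) * p)"
    proof -
      have "(2 powr (- (real j + 1))) powr p = inverse (2 powr ((real j + 1) * p))"
        unfolding powr_powr mult_minus_left by (rule powr_minus)
      then show ?thesis by (simp only: divide_inverse inverse_inverse_eq)
    qed
    finally show ?thesis using hi by (intro that[of j]) (simp add: add_increasing2)
  next
    case False
    then have "1 \<le> ?t" by simp
    then have "0 \<le> log 2 ?t" using t by simp
    then have "?t = 2 powr L" using t by (simp add: L_def)
    then have lo: "2 powr real j \<le> ?t" and hi: "?t \<le> 2 powr (real j + 1)"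
      using j by simp_all
    have "(2 powr real j) powr p \<le> ?t powr p"
      using lo p by (intro powr_mono2) auto
    then have "cutoff_kernel s z \<le> 1 / (2 powr real j) powr p"
      unfolding k using t by (intro frac_le) auto
    also have "\<dots> = 2 powr (- real j * p)"
      by (simp only: powr_powr minus_mult_left[symmetric] powr_minus divide_inverse mult_1)
    finally show ?thesis using hi by (intro that[of j]) (simp add: add_increasing)
  qed
qed

lemma nn_integral_cutoff_kernel_finite:
  assumes s: "0 < s" "s < 1"
  shows "(\<integral>\<^sup>+z. ennreal (cutoff_kernel s (z :: real^'n)) \<partial>lborel) < \<infinity>"
proof -
  let ?N = "CARD('n)"
  define p where "p = real ?N + 2 * s"
  define a where "a j = (2 powr (- real j))\<^sup>2 * 2 powr ((real j + 1) * p)" for j :: nat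
  define b where "b j = 2 powr (- real j * p)" for j :: nat
  define V where "V = unit_ball_vol (real ?N)"
  have nonneg: "0 \<le> a j" "0 \<le> b j" "0 \<le> V" for j by (auto simp: a_def b_def V_def)
  define F where "F j z = ennreal (a j) * indicator (cball 0 (2 powr (- real j))) z
      + ennreal (b j) * indicator (cball 0 (2 powr (real j + 1))) z" for j and z :: "real^'n"
  have [measurable]: "cball (0::real^'n) t \<in> sets borel" for t by simp
  have F[measurable]: "F j \<in> borel_measurable lborel" for j
    unfolding F_def by measurable
  have "ennreal (cutoff_kernel s z) \<le> (\<Sum>j. F j z)" for z
  proof -
    obtain j where "cutoff_kernel s z \<le> a j * indicator (cball 0 (2 powr (- real j))) z
        + b j * indicator (cball 0 (2 powr (real j + 1))) z"
      using cutoff_kernel_le_dyadic[OF s(1), of z] unfolding a_def b_def p_def by blast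
    then have "ennreal (cutoff_kernel s z) \<le> ennreal (a j * indicator (cball 0 (2 powr (- real j))) z
        + b j * indicator (cball 0 (2 powr (real j + 1))) z)" by (rule ennreal_leI)
    also have "\<dots> = F j z" using nonneg by (auto simp: F_def indicator_def)
    also have "\<dots> \<le> (\<Sum>j. F j z)" using sum_le_suminf[of "\<lambda>j. F j z" "{j}"] by simp
    finally show ?thesis .
  qed
  then have "(\<integral>\<^sup>+z. ennreal (cutoff_kernel s (z :: real^'n)) \<partial>lborel) \<le> (\<integral>\<^sup>+z. (\<Sum>j. F j z) \<partial>lborel)"
    by (intro nn_integral_mono)
  also have "\<dots> = (\<Sum>j. \<integral>\<^sup>+z. F j z \<partial>lborel)" by (intro nn_integral_suminf F)
  also have "(\<lambda>j. \<integral>\<^sup>+z. F j z \<partial>lborel)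
      = (\<lambda>j. ennreal (V * 2 powr p * (2 powr (2 * s - 2)) ^ j + V * 2 ^ ?N * (2 powr (- 2 * s)) ^ j))"
  proof
    fix j
    have "(\<integral>\<^sup>+z. F j z \<partial>lborel) = ennreal (a j) * emeasure lborel (cball (0::real^'n) (2 powr (- real j)))
        + ennreal (b j) * emeasure lborel (cball (0::real^'n) (2 powr (real j + 1)))"
      unfolding F_def by (simp add: nn_integral_add nn_integral_cmult_indicator)
    also have "\<dots> = ennreal (a j * (V * (2 powr (- real j)) ^ ?N) + b j * (V * (2 powr (real j + 1)) ^ ?N))"
      using nonneg by (simp add: emeasure_cball V_def ennreal_mult)
    also have "a j * (V * (2 powr (- real j)) ^ ?N) = V * 2 powr p * (2 powr (2 * s - 2)) ^ j"
    proof -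
      have "(2 powr (- real j))\<^sup>2 * 2 powr ((real j + 1) * p) * (2 powr (- real j)) ^ ?N
          = 2 powr (- real j * 2 + (real j + 1) * p + - real j * real ?N)"
        by (simp only: two_powr_power powr_add of_nat_numeral)
      also have "- real j * 2 + (real j + 1) * p + - real j * real ?N = p + (2 * s - 2) * real j"
        by (simp add: p_def algebra_simps)
      also have "2 powr (p + (2 * s - 2) * real j) = 2 powr p * (2 powr (2 * s - 2)) ^ j"
        by (simp only: two_powr_power powr_add)
      finally show ?thesis by (simp add: a_def mult_ac)
    qed
    also have "b j * (V * (2 powr (real j + 1)) ^ ?N) = V * 2 ^ ?N * (2 powr (- 2 * s)) ^ j"
    proof -
      have "2 powr (- real j * p) * (2 powr (real j + 1)) ^ ?N = 2 powr (- real j * p + (real j + 1) * real ?N)"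
        unfolding two_powr_power by (rule powr_add[symmetric])
      also have "- real j * p + (real j + 1) * real ?N = real ?N + - 2 * s * real j"
        by (simp add: p_def algebra_simps)
      also have "2 powr (real ?N + - 2 * s * real j) = 2 ^ ?N * (2 powr (- 2 * s)) ^ j"
        unfolding two_powr_power by (subst powr_add) (simp add: powr_realpow)
      finally show ?thesis by (simp add: b_def mult_ac)
    qed
    finally show "(\<integral>\<^sup>+z. F j z \<partial>lborel)
        = ennreal (V * 2 powr p * (2 powr (2 * s - 2)) ^ j + V * 2 ^ ?N * (2 powr (- 2 * s)) ^ j)" .
  qed
  also have "(\<Sum>j. ennreal (V * 2 powr p * (2 powr (2 * s - 2)) ^ j + V * 2 ^ ?N * (2 powr (- 2 * s)) ^ j)) < \<infinity>"
  proof -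
    have "(2::real) powr (2 * s - 2) < 2 powr 0" "(2::real) powr (- 2 * s) < 2 powr 0"
      using s by (intro powr_less_mono; simp)+
    then have "summable (\<lambda>j. V * 2 powr p * (2 powr (2 * s - 2)) ^ j + V * 2 ^ ?N * (2 powr (- 2 * s)) ^ j)"
      by (intro summable_add summable_mult summable_geometric) auto
    then show ?thesis
      using nonneg(3) by (subst suminf_ennreal2) auto
  qed
  finally show ?thesis .
qed

lemma cutoff_kernel_measurable [measurable]: "cutoff_kernel s \<in> borel_measurable borel"
  unfolding cutoff_kernel_def by measurable

lemma cutoff_kernel_minus: "cutoff_kernel s (- z) = cutoff_kernel s z"
  by (simp add: cutoff_kernel_def)

lemma nn_integral_lborel_translation:
  fixes k :: "'a::euclidean_space \<Rightarrow> ennreal"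
  assumes [measurable]: "k \<in> borel_measurable borel"
  shows "(\<integral>\<^sup>+x. k (x - y) \<partial>lborel) = (\<integral>\<^sup>+x. k x \<partial>lborel)"
proof -
  have "(\<integral>\<^sup>+x. k x \<partial>lborel) = (\<integral>\<^sup>+x. k x \<partial>distr lborel borel ((+) (- y)))"
    by (simp only: lborel_distr_plus)
  also have "\<dots> = (\<integral>\<^sup>+x. k (- y + x) \<partial>lborel)"
    by (intro nn_integral_distr) auto
  finally show ?thesis by simp
qed

definition tent :: "real ^ 'n \<Rightarrow> real" where
  "tent x = max 0 (1 - norm x)"

lemma tent_measurable [measurable]: "tent \<in> borel_measurable borel"
  unfolding tent_def by measurable

lemma tent_sq_le_indicator: "(tent x)\<^sup>2 \<le> indicator (cball 0 1) x"
  by (auto simp: tent_def indicator_def max_def power_le_one)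

lemma sq_integrable_tent: "sq_integrable lborel (tent :: real^'n \<Rightarrow> real)"
proof (rule sq_integrable_of_nn_integral_le)
  have "ennreal ((norm (tent x))\<^sup>2) \<le> indicator (cball 0 1) x" for x :: "real^'n"
    using ennreal_leI[OF tent_sq_le_indicator[of x]] by (simp only: ennreal_indicator real_norm_def power2_abs)
  then have "(\<integral>\<^sup>+x. ennreal ((norm (tent (x::real^'n)))\<^sup>2) \<partial>lborel) \<le> (\<integral>\<^sup>+x. indicator (cball (0::real^'n) 1) x \<partial>lborel)"
    by (intro nn_integral_mono)
  also have "\<dots> = ennreal (measure lborel (cball (0::real^'n) 1))"
    using emeasure_lborel_cball_finite[of "0::real^'n" 1] by (simp add: emeasure_eq_ennreal_measure)
  finally show "(\<integral>\<^sup>+x. ennreal ((norm (tent (x::real^'n)))\<^sup>2) \<partial>lborel) \<le> ennreal (measure lborel (cball (0::real^'n) 1))" .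
qed simp

lemma sq_integrable_weight_tent: "sq_integrable lborel (\<lambda>x::real^'n. norm x *\<^sub>R tent x)"
proof (rule sq_integrable_mono[OF sq_integrable_tent, where K=1])
  fix x :: "real^'n"
  have "norm x * tent x \<le> tent x" "0 \<le> norm x * tent x"
    by (auto simp: tent_def max_def mult_left_le_one_le)
  then show "(norm (norm x *\<^sub>R tent x))\<^sup>2 \<le> 1 * (norm (tent x))\<^sup>2"
    by (auto intro!: power_mono)
qed measurable

lemma sq_norm_tent_pos: "0 < sq_norm lborel (tent :: real^'n \<Rightarrow> real)"
proof (rule ccontr)
  assume "\<not> ?thesis"
  then have "sq_norm lborel (tent :: real^'n \<Rightarrow> real) = 0" using sq_norm_nonneg[of lborel "tent :: real^'n \<Rightarrow> real"] by linarith
  then have "AE x::real^'n in lborel. (norm (tent x))\<^sup>2 = 0"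
    using sq_integrable_tent unfolding sq_norm_def sq_integrable_def
    by (subst (asm) integral_nonneg_eq_0_iff_AE) auto
  then have "AE x::real^'n in lborel. x \<notin> ball 0 1"
    by eventually_elim (auto simp: tent_def max_def split: if_splits)
  then have "emeasure lborel (ball (0::real^'n) 1) = 0"
    by (subst (asm) AE_iff_measurable[OF _ refl]) (auto simp: ball_def)
  then show False using unit_ball_vol_pos[of "real CARD('n)"] by (simp add: emeasure_ball)
qed

lemma gag_quotient_tent_sq_le:
  fixes x y :: "real^'n"
  shows "(norm (gag_quotient s tent (x, y)))\<^sup>2
    \<le> (indicator (cball 0 1) x + indicator (cball 0 1) y) * cutoff_kernel s (x - y)"
proof (cases "x \<in> cball 0 1 \<or> y \<in> cball 0 1")
  case True
  have k0: "0 \<le> cutoff_kernel s (x - y)" by (simp add: cutoff_kernel_def)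
  have "\<bar>tent x - tent y\<bar> \<le> norm (x - y)" "\<bar>tent x - tent y\<bar> \<le> 1"
    using norm_triangle_ineq3[of x y] norm_ge_zero[of x] norm_ge_zero[of y]
    unfolding tent_def by linarith+
  then have "(norm (tent x - tent y))\<^sup>2 \<le> min 1 ((norm (x - y))\<^sup>2)"
    by (auto simp: abs_square_le_1 power2_le_iff_abs_le intro!: power_mono)
  then have "(norm (gag_quotient s tent (x, y)))\<^sup>2 \<le> 1 * cutoff_kernel s (x - y)"
    unfolding norm_gag_quotient_sq cutoff_kernel_def by (simp add: divide_right_mono)
  also have "\<dots> \<le> (indicator (cball 0 1) x + indicator (cball 0 1) y) * cutoff_kernel s (x - y)"
    using True k0 by (intro mult_right_mono) (auto simp: indicator_def)
  finally show ?thesis .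
next
  case False
  then have "tent x = 0" "tent y = 0" by (auto simp: tent_def)
  then show ?thesis using False by (simp add: gag_quotient_def)
qed

lemma sq_integrable_gag_quotient_tent:
  assumes s: "0 < s" "s < 1"
  shows "sq_integrable (lborel \<Otimes>\<^sub>M lborel) (gag_quotient s (tent :: real^'n \<Rightarrow> real))"
proof -
  let ?B = "cball (0 :: real^'n) 1"
  let ?k = "\<lambda>x y :: real^'n. ennreal (cutoff_kernel s (x - y))"
  define I where "I = (\<integral>\<^sup>+z. ennreal (cutoff_kernel s (z :: real^'n)) \<partial>lborel)"
  have I: "I < \<infinity>" unfolding I_def by (rule nn_integral_cutoff_kernel_finite[OF s])
  have [measurable]: "?B \<in> sets borel" by simp
  have Ix: "(\<integral>\<^sup>+x. ?k x y \<partial>lborel) = I" for y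
    unfolding I_def by (rule nn_integral_lborel_translation[of "\<lambda>z. ennreal (cutoff_kernel s z)"]) measurable
  have Iy: "(\<integral>\<^sup>+y. ?k x y \<partial>lborel) = I" for x
  proof -
    have "?k x y = ?k y x" for y using cutoff_kernel_minus[of s "x - y"] by simp
    then show ?thesis using Ix[of x] by simp
  qed
  have [measurable]: "gag_quotient s (tent :: real^'n \<Rightarrow> real) \<in> borel_measurable (lborel \<Otimes>\<^sub>M lborel)"
    by measurable
  have "(\<integral>\<^sup>+z. ennreal ((norm (gag_quotient s (tent :: real^'n \<Rightarrow> real) z))\<^sup>2) \<partial>(lborel \<Otimes>\<^sub>M lborel))
      = (\<integral>\<^sup>+x. \<integral>\<^sup>+y. ennreal ((norm (gag_quotient s (tent :: real^'n \<Rightarrow> real) (x, y)))\<^sup>2) \<partial>lborel \<partial>lborel)"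
    by (intro lborel.nn_integral_fst[symmetric]) measurable
  also have "\<dots> \<le> (\<integral>\<^sup>+x. \<integral>\<^sup>+y. indicator ?B x * ?k x y + indicator ?B y * ?k x y \<partial>lborel \<partial>lborel)"
  proof (intro nn_integral_mono)
    fix x y :: "real^'n"
    have "ennreal ((norm (gag_quotient s tent (x, y)))\<^sup>2)
        \<le> ennreal ((indicator ?B x + indicator ?B y) * cutoff_kernel s (x - y))"
      by (intro ennreal_leI gag_quotient_tent_sq_le)
    also have "\<dots> = indicator ?B x * ?k x y + indicator ?B y * ?k x y"
    proof -
      have "0 \<le> cutoff_kernel s (x - y)" by (simp add: cutoff_kernel_def)
      then show ?thesis
        by (subst distrib_right, subst ennreal_plus) (auto simp only: ennreal_mult ennreal_indicator indicator_pos_le mult_nonneg_nonneg)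
    qed
    finally show "ennreal ((norm (gag_quotient s tent (x, y)))\<^sup>2) \<le> indicator ?B x * ?k x y + indicator ?B y * ?k x y" .
  qed
  also have "\<dots> = (\<integral>\<^sup>+x. indicator ?B x * I \<partial>lborel) + (\<integral>\<^sup>+x. \<integral>\<^sup>+y. indicator ?B y * ?k x y \<partial>lborel \<partial>lborel)"
    by (simp add: nn_integral_add nn_integral_cmult Iy)
  also have "(\<integral>\<^sup>+x. \<integral>\<^sup>+y. indicator ?B y * ?k x y \<partial>lborel \<partial>lborel) = (\<integral>\<^sup>+y. \<integral>\<^sup>+x. indicator ?B y * ?k x y \<partial>lborel \<partial>lborel)"
    by (intro lborel_pair.Fubini') measurable
  also have "\<dots> = (\<integral>\<^sup>+y. indicator ?B y * I \<partial>lborel)"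
    by (simp add: nn_integral_cmult Ix)
  also have "(\<integral>\<^sup>+y. indicator ?B y * I \<partial>lborel) = emeasure lborel ?B * I"
    by (simp add: nn_integral_multc)
  also have "emeasure lborel ?B * I + emeasure lborel ?B * I < \<infinity>"
    using I emeasure_lborel_cball_finite[of "0::real^'n" 1] by (simp add: ennreal_mult_less_top)
  finally have fin: "(\<integral>\<^sup>+z. ennreal ((norm (gag_quotient s (tent :: real^'n \<Rightarrow> real) z))\<^sup>2) \<partial>(lborel \<Otimes>\<^sub>M lborel)) < \<infinity>" .
  then obtain W where "(\<integral>\<^sup>+z. ennreal ((norm (gag_quotient s (tent :: real^'n \<Rightarrow> real) z))\<^sup>2) \<partial>(lborel \<Otimes>\<^sub>M lborel)) = ennreal W"
    by (metis ennreal_cases infinity_ennreal_def less_irrefl)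
  then show ?thesis by (intro sq_integrable_of_nn_integral_le(1)[where B=W]) auto
qed

section \<open>The energy space as an intersection of square-integrability conditions\<close>

abbreviation gag_sq :: "real \<Rightarrow> (real ^ 'n \<Rightarrow> 'b::euclidean_space) \<Rightarrow> real" where
  "gag_sq s f \<equiv> sq_norm (lborel \<Otimes>\<^sub>M lborel) (gag_quotient s f)"

abbreviation weight_sq :: "(real ^ 'n \<Rightarrow> 'b::euclidean_space) \<Rightarrow> real" where
  "weight_sq f \<equiv> sq_norm lborel (\<lambda>x. norm x *\<^sub>R f x)"

lemma gagliardo_integrand_eq: "gagliardo_integrand s u z = (norm (gag_quotient s u z))\<^sup>2"
  using norm_gag_quotient_sq[of s u "fst z" "snd z"]
  by (simp add: gagliardo_integrand_def case_prod_beta)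

lemma gagliardo_eq: "gagliardo s u = gag_sq s u"
  by (simp add: gagliardo_def sq_norm_def gagliardo_integrand_eq)

lemma Sigma_space_iff:
  "u \<in> Sigma_space s \<longleftrightarrow> sq_integrable lborel u \<and> sq_integrable (lborel \<Otimes>\<^sub>M lborel) (gag_quotient s u)
    \<and> sq_integrable lborel (\<lambda>x. norm x *\<^sub>R u x)"
  by (auto simp: Sigma_space_def H_space_def L2_space_def sq_integrable_def power_mult_distrib
      gagliardo_integrand_eq[abs_def])

lemma gag_quotient_Re: "gag_quotient s (\<lambda>x. Re (f x)) = (\<lambda>z. Re (gag_quotient s f z))"
  and gag_quotient_Im: "gag_quotient s (\<lambda>x. Im (f x)) = (\<lambda>z. Im (gag_quotient s f z))"
  by (auto simp: gag_quotient_def fun_eq_iff)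

lemma sq_integrable_complex_iff:
  fixes f :: "'a \<Rightarrow> complex"
  shows "sq_integrable M f \<longleftrightarrow> sq_integrable M (\<lambda>x. Re (f x)) \<and> sq_integrable M (\<lambda>x. Im (f x))"
proof
  assume f: "sq_integrable M f"
  then have [measurable]: "f \<in> borel_measurable M" by (simp add: sq_integrable_def)
  show "sq_integrable M (\<lambda>x. Re (f x)) \<and> sq_integrable M (\<lambda>x. Im (f x))"
    by (intro conjI sq_integrable_mono[OF f, where K=1]; simp add: cmod_power2; measurable)
next
  assume f: "sq_integrable M (\<lambda>x. Re (f x)) \<and> sq_integrable M (\<lambda>x. Im (f x))"
  then have [measurable]: "(\<lambda>x. Re (f x)) \<in> borel_measurable M" "(\<lambda>x. Im (f x)) \<in> borel_measurable M"
    by (auto simp: sq_integrable_def)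
  have "f \<in> borel_measurable M" by (simp add: borel_measurable_complex_iff)
  moreover have "integrable M (\<lambda>x. (Re (f x))\<^sup>2 + (Im (f x))\<^sup>2)"
    using f by (intro Bochner_Integration.integrable_add) (auto simp: sq_integrable_def)
  ultimately show "sq_integrable M f" by (simp add: sq_integrable_def cmod_power2)
qed

lemma sq_norm_complex:
  fixes f :: "'a \<Rightarrow> complex"
  assumes "sq_integrable M f"
  shows "sq_norm M f = sq_norm M (\<lambda>x. Re (f x)) + sq_norm M (\<lambda>x. Im (f x))"
  using assms[unfolded sq_integrable_complex_iff] by (simp add: sq_norm_def sq_integrable_def cmod_power2)

lemma cSigma_space_iff:
  "\<omega> \<in> cSigma_space s \<longleftrightarrow> sq_integrable lborel \<omega> \<and> sq_integrable (lborel \<Otimes>\<^sub>M lborel) (gag_quotient s \<omega>)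
    \<and> sq_integrable lborel (\<lambda>x. norm x *\<^sub>R \<omega> x)"
  unfolding cSigma_space_def mem_Collect_eq Sigma_space_iff gag_quotient_Re gag_quotient_Im
    sq_integrable_complex_iff[of lborel \<omega>] sq_integrable_complex_iff[of "lborel \<Otimes>\<^sub>M lborel"]
    sq_integrable_complex_iff[of lborel "\<lambda>x. norm x *\<^sub>R \<omega> x"]
  by auto

lemma cSigma_spaceD:
  assumes "\<omega> \<in> cSigma_space s"
  shows "sq_integrable lborel \<omega>" "sq_integrable (lborel \<Otimes>\<^sub>M lborel) (gag_quotient s \<omega>)"
    "sq_integrable lborel (\<lambda>x. norm x *\<^sub>R \<omega> x)"
  using assms by (auto simp: cSigma_space_iff)

lemma gag_quotient_diff: "gag_quotient s (\<lambda>x. f x - g x) = (\<lambda>z. gag_quotient s f z - gag_quotient s g z)"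
  by (auto simp: gag_quotient_def fun_eq_iff algebra_simps)

lemma cSigma_space_diff:
  assumes "f \<in> cSigma_space s" "g \<in> cSigma_space s"
  shows "(\<lambda>x. f x - g x) \<in> cSigma_space s"
  using assms by (auto simp: cSigma_space_iff gag_quotient_diff scaleR_diff_right intro: sq_integrable_diff)

lemma L2_norm_eq: "L2_norm f = sqrt (sq_norm lborel f)"
  by (simp add: L2_norm_def sq_norm_def)

lemma L2_norm_weight_eq: "L2_norm (\<lambda>x. u x *\<^sub>R x) = sqrt (weight_sq u)"
  by (simp add: L2_norm_def sq_norm_def power_mult_distrib mult.commute)

lemma Sigma_norm_eq: "Sigma_norm C s u = sqrt (sq_norm lborel u) + sqrt (C * gag_sq s u) + sqrt (weight_sq u)"
  by (simp add: Sigma_norm_def L2_norm_eq[of u] L2_norm_weight_eq grad_norm_def gagliardo_eq)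

lemma cgrad_norm_sq:
  assumes "\<omega> \<in> cSigma_space s" "0 < C"
  shows "(cgrad_norm C s \<omega>)\<^sup>2 = C * gag_sq s \<omega>"
  using assms(2) sq_norm_complex[OF cSigma_spaceD(2)[OF assms(1)]]
  by (simp add: cgrad_norm_def grad_norm_def gagliardo_eq gag_quotient_Re gag_quotient_Im distrib_left)

text \<open>
  The norm adds up three \<open>L\<^sup>2\<close> norms for the real and for the imaginary part. It is equivalent to the
  root of the sum of the three complex quadratic forms, which are easier to pass to the limit in.
\<close>

lemma cSigma_norm_sq_bounds:
  assumes \<omega>: "\<omega> \<in> cSigma_space s" and C: "0 < C"
  shows "sq_norm lborel \<omega> + C * gag_sq s \<omega> + weight_sq \<omega> \<le> (cSigma_norm C s \<omega>)\<^sup>2"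
    and "(cSigma_norm C s \<omega>)\<^sup>2 \<le> 3 * (sq_norm lborel \<omega> + C * gag_sq s \<omega> + weight_sq \<omega>)"
proof -
  define a1 a2 where "a1 = sqrt (sq_norm lborel (\<lambda>x. Re (\<omega> x)))" and "a2 = sqrt (sq_norm lborel (\<lambda>x. Im (\<omega> x)))"
  define b1 b2 where "b1 = sqrt (C * gag_sq s (\<lambda>x. Re (\<omega> x)))" and "b2 = sqrt (C * gag_sq s (\<lambda>x. Im (\<omega> x)))"
  define c1 c2 where "c1 = sqrt (weight_sq (\<lambda>x. Re (\<omega> x)))" and "c2 = sqrt (weight_sq (\<lambda>x. Im (\<omega> x)))"
  have nonneg: "0 \<le> a1" "0 \<le> a2" "0 \<le> b1" "0 \<le> b2" "0 \<le> c1" "0 \<le> c2"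
    using C by (auto simp: a1_def a2_def b1_def b2_def c1_def c2_def)
  have n: "(cSigma_norm C s \<omega>)\<^sup>2 = (a1 + b1 + c1)\<^sup>2 + (a2 + b2 + c2)\<^sup>2"
    by (simp add: cSigma_norm_def Sigma_norm_eq a1_def a2_def b1_def b2_def c1_def c2_def)
  have q: "sq_norm lborel \<omega> + C * gag_sq s \<omega> + weight_sq \<omega> = (a1\<^sup>2 + b1\<^sup>2 + c1\<^sup>2) + (a2\<^sup>2 + b2\<^sup>2 + c2\<^sup>2)"
    using C sq_norm_complex[OF cSigma_spaceD(1)[OF \<omega>]] sq_norm_complex[OF cSigma_spaceD(2)[OF \<omega>]]
      sq_norm_complex[OF cSigma_spaceD(3)[OF \<omega>]]
    by (simp add: a1_def a2_def b1_def b2_def c1_def c2_def gag_quotient_Re gag_quotient_Im distrib_left)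
  have lo: "a\<^sup>2 + b\<^sup>2 + c\<^sup>2 \<le> (a + b + c)\<^sup>2" if "0 \<le> a" "0 \<le> b" "0 \<le> c" for a b c :: real
    using that by (simp add: power2_eq_square algebra_simps)
  have hi: "(a + b + c)\<^sup>2 \<le> 3 * (a\<^sup>2 + b\<^sup>2 + c\<^sup>2)" for a b c :: real
  proof -
    have "0 \<le> (a - b)\<^sup>2 + (b - c)\<^sup>2 + (a - c)\<^sup>2" by simp
    also have "\<dots> = 3 * (a\<^sup>2 + b\<^sup>2 + c\<^sup>2) - (a + b + c)\<^sup>2" by (simp add: power2_eq_square algebra_simps)
    finally show ?thesis by simp
  qed
  show "sq_norm lborel \<omega> + C * gag_sq s \<omega> + weight_sq \<omega> \<le> (cSigma_norm C s \<omega>)\<^sup>2"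
    unfolding n q using lo nonneg by (intro add_mono) auto
  show "(cSigma_norm C s \<omega>)\<^sup>2 \<le> 3 * (sq_norm lborel \<omega> + C * gag_sq s \<omega> + weight_sq \<omega>)"
    unfolding n q using add_mono[OF hi[of a1 b1 c1] hi[of a2 b2 c2]] by (simp only: distrib_left)
qed

lemma cSigma_norm_nonneg: "0 \<le> cSigma_norm C s \<omega>"
  by (simp add: cSigma_norm_def)

lemma cSigma_norm_tendsto_0_iff:
  assumes d: "\<And>n. d n \<in> cSigma_space s" and C: "0 < C"
  shows "(\<lambda>n. cSigma_norm C s (d n)) \<longlonglongrightarrow> 0 \<longleftrightarrow>
    (\<lambda>n. sq_norm lborel (d n)) \<longlonglongrightarrow> 0 \<and> (\<lambda>n. gag_sq s (d n)) \<longlonglongrightarrow> 0 \<and> (\<lambda>n. weight_sq (d n)) \<longlonglongrightarrow> 0"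
proof
  assume "(\<lambda>n. cSigma_norm C s (d n)) \<longlonglongrightarrow> 0"
  then have lim: "(\<lambda>n. (cSigma_norm C s (d n))\<^sup>2) \<longlonglongrightarrow> 0"
    using tendsto_power[of _ 0 _ 2] by fastforce
  have nonneg: "0 \<le> sq_norm lborel (d n)" "0 \<le> C * gag_sq s (d n)" "0 \<le> weight_sq (d n)" for n
    using C by auto
  have b: "sq_norm lborel (d n) \<le> (cSigma_norm C s (d n))\<^sup>2" "C * gag_sq s (d n) \<le> (cSigma_norm C s (d n))\<^sup>2"
    "weight_sq (d n) \<le> (cSigma_norm C s (d n))\<^sup>2" for n
    using cSigma_norm_sq_bounds(1)[OF d C, of n] nonneg[of n] by linarith+
  have "(\<lambda>n. sq_norm lborel (d n)) \<longlonglongrightarrow> 0" "(\<lambda>n. weight_sq (d n)) \<longlonglongrightarrow> 0"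
    by (rule tendsto_sandwich[OF _ _ tendsto_const lim]; use b in simp)+
  moreover have "(\<lambda>n. C * gag_sq s (d n)) \<longlonglongrightarrow> 0"
    by (rule tendsto_sandwich[OF _ _ tendsto_const lim]; use b C in simp)
  then have "(\<lambda>n. gag_sq s (d n)) \<longlonglongrightarrow> 0" using C by (simp add: tendsto_mult_left_iff[of C _ 0, simplified])
  ultimately show "(\<lambda>n. sq_norm lborel (d n)) \<longlonglongrightarrow> 0 \<and> (\<lambda>n. gag_sq s (d n)) \<longlonglongrightarrow> 0 \<and> (\<lambda>n. weight_sq (d n)) \<longlonglongrightarrow> 0"
    by blast
next
  assume a: "(\<lambda>n. sq_norm lborel (d n)) \<longlonglongrightarrow> 0 \<and> (\<lambda>n. gag_sq s (d n)) \<longlonglongrightarrow> 0 \<and> (\<lambda>n. weight_sq (d n)) \<longlonglongrightarrow> 0"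
  then have "(\<lambda>n. 3 * (sq_norm lborel (d n) + C * gag_sq s (d n) + weight_sq (d n))) \<longlonglongrightarrow> 3 * (0 + C * 0 + 0)"
    by (intro tendsto_intros) auto
  then have lim: "(\<lambda>n. 3 * (sq_norm lborel (d n) + C * gag_sq s (d n) + weight_sq (d n))) \<longlonglongrightarrow> 0" by simp
  have "(\<lambda>n. (cSigma_norm C s (d n))\<^sup>2) \<longlonglongrightarrow> 0"
    by (rule tendsto_sandwich[OF _ _ tendsto_const lim]) (use cSigma_norm_sq_bounds(2)[OF d C] in auto)
  then have "(\<lambda>n. sqrt ((cSigma_norm C s (d n))\<^sup>2)) \<longlonglongrightarrow> sqrt 0" by (intro tendsto_intros)
  then show "(\<lambda>n. cSigma_norm C s (d n)) \<longlonglongrightarrow> 0" by (simp add: cSigma_norm_nonneg)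
qed

lemma cSigma_norm_minus_commute:
  fixes f g :: "real^'n \<Rightarrow> complex"
  shows
  "cSigma_norm C s (\<lambda>x. f x - g x) = cSigma_norm C s (\<lambda>x. g x - f x)"
proof -
  have "Sigma_norm C s (\<lambda>x. u x - v x) = Sigma_norm C s (\<lambda>x. v x - u x)" for u v :: "real^'n \<Rightarrow> real"
    unfolding Sigma_norm_eq sq_norm_def gag_quotient_diff scaleR_diff_right by (simp only: norm_minus_commute)
  from this[of "\<lambda>x. Re (f x)" "\<lambda>x. Re (g x)"] this[of "\<lambda>x. Im (f x)" "\<lambda>x. Im (g x)"]
  show ?thesis by (simp add: cSigma_norm_def)
qed

lemma mass_sphere_iff: "\<omega> \<in> mass_sphere s c \<longleftrightarrow> \<omega> \<in> cSigma_space s \<and> sq_norm lborel \<omega> = c\<^sup>2"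
  by (simp add: mass_sphere_def sq_norm_def)

lemma mass_sphere_nonempty:
  assumes s: "0 < s" "s < 1"
  shows "(mass_sphere s c :: (real^'n \<Rightarrow> complex) set) \<noteq> {}"
proof -
  define m where "m = sq_norm lborel (tent :: real^'n \<Rightarrow> real)"
  have m: "0 < m" unfolding m_def by (rule sq_norm_tent_pos)
  define \<omega> where "\<omega> x = complex_of_real (c / sqrt m * tent x)" for x :: "real^'n"
  have gag: "gag_quotient s (\<lambda>x. a *\<^sub>R tent x) = (\<lambda>z. a *\<^sub>R gag_quotient s tent z)" for a :: real
    by (auto simp: gag_quotient_def fun_eq_iff algebra_simps)
  have "(\<lambda>x. (c / sqrt m) *\<^sub>R tent (x::real^'n)) \<in> Sigma_space s"
    unfolding Sigma_space_iff gag scaleR_left_commute[of "norm _"]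
    by (intro conjI sq_integrable_scaleR sq_integrable_tent sq_integrable_gag_quotient_tent s sq_integrable_weight_tent)
  moreover have "(\<lambda>x::real^'n. 0 :: real) \<in> Sigma_space s"
    by (auto simp: Sigma_space_iff sq_integrable_def gag_quotient_def case_prod_beta)
  ultimately have "\<omega> \<in> cSigma_space s" by (simp add: cSigma_space_def \<omega>_def)
  moreover have "sq_norm lborel \<omega> = c\<^sup>2"
  proof -
    have "sq_norm lborel \<omega> = sq_norm lborel (\<lambda>x::real^'n. (c / sqrt m) *\<^sub>R tent x)"
      by (simp add: sq_norm_def \<omega>_def norm_mult norm_divide abs_mult)
    also have "\<dots> = (c / sqrt m)\<^sup>2 * m" unfolding m_def by (rule sq_norm_scaleR)
    also have "\<dots> = c\<^sup>2" using m by (simp add: power_divide)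
    finally show ?thesis .
  qed
  ultimately show ?thesis by (auto simp: mass_sphere_iff)
qed

section \<open>Coercivity and continuity of the energy\<close>

abbreviation potential :: "real \<Rightarrow> (real ^ 'n \<Rightarrow> complex) \<Rightarrow> real" where
  "potential \<sigma> \<omega> \<equiv> (LINT x|lborel. norm (\<omega> x) powr (2 * \<sigma> + 2))"

lemma J_fun_eq:
  assumes "\<omega> \<in> cSigma_space s" "0 < C"
  shows "J_fun C s \<sigma> \<omega> = 1 / 2 * (C * gag_sq s \<omega> + weight_sq \<omega>) - 1 / (2 * \<sigma> + 2) * potential \<sigma> \<omega>"
  by (simp add: J_fun_def cgrad_norm_sq[OF assms] sq_norm_def[of lborel "\<lambda>x. norm x *\<^sub>R \<omega> x"]
      power_mult_distrib distrib_left)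

lemma subcritical_exponents:
  assumes "0 < \<sigma>" "\<sigma> < 2 * s / real CARD('n::finite)"
  shows "2 < 2 * \<sigma> + 2" "2 * \<sigma> + 2 < 2 + 4 * s / real CARD('n)"
  using assms by (auto simp: field_simps)

lemma integrable_potential:
  fixes \<omega> :: "real^'n \<Rightarrow> complex"
  assumes s: "0 < s" and \<sigma>: "0 < \<sigma>" "\<sigma> < 2 * s / real CARD('n)" and \<omega>: "\<omega> \<in> cSigma_space s"
  shows "integrable lborel (\<lambda>x. norm (\<omega> x) powr (2 * \<sigma> + 2))"
proof (rule integrable_powr_between[OF subcritical_exponents[OF \<sigma>] cSigma_spaceD(1)[OF \<omega>]])
  have "0 < sq_norm lborel \<omega> + 1" by (intro add_nonneg_pos) auto
  then show "integrable lborel (\<lambda>x. norm (\<omega> x) powr (2 + 4 * s / real CARD('n)))"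
    by (rule integrable_critical_power[OF s cSigma_spaceD(1,2)[OF \<omega>]]) simp
qed

lemma energy_eq_twice_J_fun:
  fixes \<omega> :: "real^'n \<Rightarrow> complex"
  assumes s: "0 < s" and \<sigma>: "0 < \<sigma>" "\<sigma> < 2 * s / real CARD('n)" and \<omega>: "\<omega> \<in> cSigma_space s" and C: "0 < C"
  shows "energy C s \<sigma> \<omega> = 2 * J_fun C s \<sigma> \<omega>"
proof -
  have w: "integrable lborel (\<lambda>x. (norm x)\<^sup>2 * (norm (\<omega> x))\<^sup>2)"
    using cSigma_spaceD(3)[OF \<omega>] by (simp add: sq_integrable_def power_mult_distrib)
  have "energy C s \<sigma> \<omega> = (cgrad_norm C s \<omega>)\<^sup>2 + (LINT x|lborel. (norm x)\<^sup>2 * (norm (\<omega> x))\<^sup>2)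
      - 1 / (\<sigma> + 1) * potential \<sigma> \<omega>"
    unfolding energy_def using w integrable_potential[OF s \<sigma> \<omega>] by simp
  also have "\<dots> = 2 * J_fun C s \<sigma> \<omega>"
    using \<sigma>(1) by (simp add: J_fun_def field_simps)
  finally show ?thesis .
qed

text \<open>
  At fixed mass, the critical power is linear in the Gagliardo seminorm; a subcritical power is
  therefore bounded by an arbitrarily small multiple of the seminorm plus a constant.
\<close>

lemma J_fun_coercive:
  assumes s: "0 < s" and \<sigma>: "0 < \<sigma>" "\<sigma> < 2 * s / real CARD('n)" and C: "0 < C" and M: "0 < M"
  obtains K where "\<And>\<omega> :: real^'n \<Rightarrow> complex. \<omega> \<in> cSigma_space s \<Longrightarrow> sq_norm lborel \<omega> \<le> M \<Longrightarrow>
    (C * gag_sq s \<omega> + weight_sq \<omega>) / 4 \<le> J_fun C s \<sigma> \<omega> + K"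
proof -
  let ?q = "2 + 4 * s / real CARD('n)"
  define G where "G = 4 * real CARD('n) powr (real CARD('n) + 2 * s) * (4 * M) powr (2 * s / real CARD('n))"
  have G: "0 < G" using M by (simp add: G_def)
  define d where "d = C / (2 * G)"
  have d: "0 < d" using C G by (simp add: d_def)
  obtain K where K: "0 \<le> K" "\<And>a. 0 \<le> a \<Longrightarrow> a powr (2 * \<sigma> + 2) \<le> d * a powr ?q + K * a\<^sup>2"
    using powr_interpolation[OF subcritical_exponents[OF \<sigma>] d] by blast
  have "(C * gag_sq s \<omega> + weight_sq \<omega>) / 4 \<le> J_fun C s \<sigma> \<omega> + K * M / 2"
    if \<omega>: "\<omega> \<in> cSigma_space s" "sq_norm lborel \<omega> \<le> M" for \<omega> :: "real^'n \<Rightarrow> complex"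
  proof -
    note i = integrable_critical_power[OF s cSigma_spaceD(1,2)[OF \<omega>(1)] M \<omega>(2)]
    have L2: "integrable lborel (\<lambda>x. (norm (\<omega> x))\<^sup>2)" using cSigma_spaceD(1)[OF \<omega>(1)] by (simp add: sq_integrable_def)
    have "potential \<sigma> \<omega> \<le> (LINT x|lborel. d * norm (\<omega> x) powr ?q + K * (norm (\<omega> x))\<^sup>2)"
      using K(2) i L2 integrable_potential[OF s \<sigma> \<omega>(1)] by (intro integral_mono) auto
    also have "\<dots> = d * (LINT x|lborel. norm (\<omega> x) powr ?q) + K * sq_norm lborel \<omega>"
      using i L2 by (simp add: sq_norm_def)
    also have "\<dots> \<le> d * (G * gag_sq s \<omega>) + K * M"
      using fractional_Gagliardo_Nirenberg[OF s cSigma_spaceD(1,2)[OF \<omega>(1)] M \<omega>(2)] d K(1) \<omega>(2)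
      unfolding G_def[symmetric] by (intro add_mono mult_left_mono) auto
    also have "d * (G * gag_sq s \<omega>) = C * gag_sq s \<omega> / 2" using G by (simp add: d_def)
    finally have pot: "potential \<sigma> \<omega> \<le> C * gag_sq s \<omega> / 2 + K * M" .
    have "0 \<le> potential \<sigma> \<omega>" by simp
    then have "1 / (2 * \<sigma> + 2) * potential \<sigma> \<omega> \<le> 1 / 2 * potential \<sigma> \<omega>"
      using \<sigma>(1) by (intro mult_right_mono) (auto simp: field_simps)
    moreover have "0 \<le> weight_sq \<omega>" by simp
    ultimately show ?thesis using pot unfolding J_fun_eq[OF \<omega>(1) C] by argo
  qed
  then show ?thesis using that by blast
qed

text \<open>
  The bound on the seminorms controls the critical power, so a subcritical potential follows the
  convergence in the mean square. This serves twice: for the continuity of the energy and for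
  minimizing sequences, whose seminorms are not known to converge at that point.
\<close>

lemma potential_tendsto:
  fixes \<omega> :: "nat \<Rightarrow> real^'n \<Rightarrow> complex"
  assumes s: "0 < s" and \<sigma>: "0 < \<sigma>" "\<sigma> < 2 * s / real CARD('n)"
    and \<omega>: "\<And>n. \<omega> n \<in> cSigma_space s" and \<eta>: "\<eta> \<in> cSigma_space s"
    and B: "\<And>n. sq_norm lborel (\<omega> n) \<le> B" "\<And>n. gag_sq s (\<omega> n) \<le> B"
    and lim: "(\<lambda>n. sq_norm lborel (\<lambda>x. \<omega> n x - \<eta> x)) \<longlonglongrightarrow> 0"
  shows "(\<lambda>n. potential \<sigma> (\<omega> n)) \<longlonglongrightarrow> potential \<sigma> \<eta>"
proof -
  define M where "M = B + 1 + sq_norm lborel \<eta>"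
  have B0: "0 \<le> B" using order_trans[OF sq_norm_nonneg B(1)] .
  then have M: "0 < M" "\<And>n. sq_norm lborel (\<omega> n) \<le> M" "sq_norm lborel \<eta> \<le> M"
    using B(1) sq_norm_nonneg[of lborel \<eta>] by (auto simp: M_def intro: add_pos_nonneg order_trans[OF B(1)])
  define G where "G = 4 * real CARD('n) powr (real CARD('n) + 2 * s) * (4 * M) powr (2 * s / real CARD('n))"
  have G: "0 \<le> G" unfolding G_def by (intro mult_nonneg_nonneg powr_ge_zero) simp
  have "(LINT x|lborel. norm (\<omega> n x) powr (2 + 4 * s / real CARD('n))) \<le> max B (G * B)" for n
  proof -
    have "(LINT x|lborel. norm (\<omega> n x) powr (2 + 4 * s / real CARD('n))) \<le> G * gag_sq s (\<omega> n)"
      unfolding G_def by (rule fractional_Gagliardo_Nirenberg[OF s cSigma_spaceD(1,2)[OF \<omega>] M(1,2)])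
    also have "\<dots> \<le> G * B" using B(2) G by (rule mult_left_mono)
    finally show ?thesis by simp
  qed
  then show ?thesis
    using B(1)
    by (intro integral_powr_tendsto[OF subcritical_exponents[OF \<sigma>], where B="max B (G * B)"]
        cSigma_spaceD(1)[OF \<omega>] cSigma_spaceD(1)[OF \<eta>] lim
        integrable_critical_power[OF s cSigma_spaceD(1,2)[OF \<omega>] M(1,2)]
        integrable_critical_power[OF s cSigma_spaceD(1,2)[OF \<eta>] M(1,3)])
      (auto intro: max.coboundedI1)
qed

lemma convergent_sequence_upper_bound:
  fixes a :: "nat \<Rightarrow> real"
  assumes "a \<longlonglongrightarrow> l"
  obtains B where "\<And>n. a n \<le> B"
proof -
  have "Bseq a" using assms by (intro convergent_imp_Bseq convergentI)
  then obtain B where "\<And>n. norm (a n) \<le> B" by (auto simp: Bseq_def)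
  then show ?thesis using that[of B] by (metis abs_le_D1 real_norm_def)
qed

lemma
  fixes \<omega> :: "nat \<Rightarrow> real^'n \<Rightarrow> complex"
  assumes s: "0 < s" and \<sigma>: "0 < \<sigma>" "\<sigma> < 2 * s / real CARD('n)" and C: "0 < C"
    and \<omega>: "\<And>n. \<omega> n \<in> cSigma_space s" and \<eta>: "\<eta> \<in> cSigma_space s"
    and lim: "(\<lambda>n. cSigma_norm C s (\<lambda>x. \<omega> n x - \<eta> x)) \<longlonglongrightarrow> 0"
  shows mass_continuous: "(\<lambda>n. sq_norm lborel (\<omega> n)) \<longlonglongrightarrow> sq_norm lborel \<eta>"
    and J_fun_continuous: "(\<lambda>n. J_fun C s \<sigma> (\<omega> n)) \<longlonglongrightarrow> J_fun C s \<sigma> \<eta>"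
proof -
  have d: "(\<lambda>n. sq_norm lborel (\<lambda>x. \<omega> n x - \<eta> x)) \<longlonglongrightarrow> 0"
    "(\<lambda>n. gag_sq s (\<lambda>x. \<omega> n x - \<eta> x)) \<longlonglongrightarrow> 0" "(\<lambda>n. weight_sq (\<lambda>x. \<omega> n x - \<eta> x)) \<longlonglongrightarrow> 0"
    using lim cSigma_norm_tendsto_0_iff[OF cSigma_space_diff[OF \<omega> \<eta>] C] by auto
  show mass: "(\<lambda>n. sq_norm lborel (\<omega> n)) \<longlonglongrightarrow> sq_norm lborel \<eta>"
    by (rule sq_norm_tendsto[OF cSigma_spaceD(1)[OF \<omega>] cSigma_spaceD(1)[OF \<eta>] d(1)])
  have gag: "(\<lambda>n. gag_sq s (\<omega> n)) \<longlonglongrightarrow> gag_sq s \<eta>"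
    by (rule sq_norm_tendsto[OF cSigma_spaceD(2)[OF \<omega>] cSigma_spaceD(2)[OF \<eta>] d(2)[unfolded gag_quotient_diff]])
  have weight: "(\<lambda>n. weight_sq (\<omega> n)) \<longlonglongrightarrow> weight_sq \<eta>"
    by (rule sq_norm_tendsto[OF cSigma_spaceD(3)[OF \<omega>] cSigma_spaceD(3)[OF \<eta>] d(3)[unfolded scaleR_diff_right]])
  obtain B1 B2 where "\<And>n. sq_norm lborel (\<omega> n) \<le> B1" "\<And>n. gag_sq s (\<omega> n) \<le> B2"
    using convergent_sequence_upper_bound[OF mass] convergent_sequence_upper_bound[OF gag] by metis
  then have "(\<lambda>n. potential \<sigma> (\<omega> n)) \<longlonglongrightarrow> potential \<sigma> \<eta>"
    by (intro potential_tendsto[OF s \<sigma> \<omega> \<eta> _ _ d(1), of "max B1 B2"]) (auto intro: max.coboundedI1 max.coboundedI2)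
  then show "(\<lambda>n. J_fun C s \<sigma> (\<omega> n)) \<longlonglongrightarrow> J_fun C s \<sigma> \<eta>"
    unfolding J_fun_eq[OF \<omega> C] J_fun_eq[OF \<eta> C] by (intro tendsto_intros gag weight)
qed

section \<open>Minimizing sequences\<close>

lemma AE_lborel_pair_components:
  fixes P :: "'a::euclidean_space \<Rightarrow> bool"
  assumes "AE x in lborel. P x"
  shows "AE z in lborel \<Otimes>\<^sub>M lborel. P (fst z) \<and> P (snd z)"
proof -
  obtain N where N: "{x \<in> space lborel. \<not> P x} \<subseteq> N" "emeasure lborel N = 0" "N \<in> sets lborel"
    using assms by (rule AE_E)
  show ?thesis
  proof (rule AE_I)
    show "{z \<in> space (lborel \<Otimes>\<^sub>M lborel). \<not> (P (fst z) \<and> P (snd z))} \<subseteq> N \<times> UNIV \<union> UNIV \<times> N"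
      using N(1) by auto
    have "N \<times> UNIV \<in> null_sets (lborel \<Otimes>\<^sub>M lborel)" "UNIV \<times> N \<in> null_sets (lborel \<Otimes>\<^sub>M lborel)"
      using N(2,3) by (auto simp: null_sets_def lborel.emeasure_pair_measure_Times)
    then have "N \<times> UNIV \<union> UNIV \<times> N \<in> null_sets (lborel \<Otimes>\<^sub>M lborel)" by (rule null_sets.Un)
    then show "emeasure (lborel \<Otimes>\<^sub>M lborel) (N \<times> UNIV \<union> UNIV \<times> N) = 0"
      "N \<times> UNIV \<union> UNIV \<times> N \<in> sets (lborel \<Otimes>\<^sub>M lborel)" by (auto simp: null_sets_def)
  qed
qed

lemma AE_gag_quotient_tendsto:
  fixes f :: "nat \<Rightarrow> real^'n \<Rightarrow> 'b::euclidean_space"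
  assumes "AE x in lborel. (\<lambda>n. f n x) \<longlonglongrightarrow> g x"
  shows "AE z in lborel \<Otimes>\<^sub>M lborel. (\<lambda>n. gag_quotient s (f n) z) \<longlonglongrightarrow> gag_quotient s g z"
  using AE_lborel_pair_components[OF assms]
  by eventually_elim (auto simp: gag_quotient_def case_prod_beta intro!: tendsto_intros)

text \<open>
  If the limit of the sum is already exhausted by the asymptotic lower bounds of the two terms,
  then neither term can stay above its own bound.
\<close>

lemma lower_semicontinuous_sum_tendsto:
  fixes a b :: "nat \<Rightarrow> real"
  assumes sum: "(\<lambda>n. a n + b n) \<longlonglongrightarrow> L" and L: "L \<le> \<alpha> + \<beta>"
    and a: "\<And>y. y < \<alpha> \<Longrightarrow> \<forall>\<^sub>F n in sequentially. y < a n"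
    and b: "\<And>y. y < \<beta> \<Longrightarrow> \<forall>\<^sub>F n in sequentially. y < b n"
  shows "a \<longlonglongrightarrow> \<alpha>"
proof (rule order_tendstoI[OF a])
  fix y assume y: "\<alpha> < y"
  have "\<forall>\<^sub>F n in sequentially. a n + b n < L + (y - \<alpha>) / 2"
    using y by (intro order_tendstoD(2)[OF sum]) auto
  moreover have "\<forall>\<^sub>F n in sequentially. \<beta> - (y - \<alpha>) / 2 < b n" using y by (intro b) auto
  ultimately show "\<forall>\<^sub>F n in sequentially. a n < y"
    by eventually_elim (use L in argo)
qed

text \<open>
  Coercivity bounds the sequence, compactness yields a limit \<open>g\<close> in the mean square, and the
  potential passes to the limit. The quadratic part is lower semicontinuous, so \<open>g\<close> is a minimizer;
  this in turn leaves no room for a loss in either quadratic term, and convergence of the norms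
  makes the convergence strong.
\<close>

theorem minimizing_sequence_precompact:
  fixes \<omega> :: "nat \<Rightarrow> real^'n \<Rightarrow> complex"
  assumes s: "0 < s" and \<sigma>: "0 < \<sigma>" "\<sigma> < 2 * s / real CARD('n)" and C: "0 < C"
    and \<omega>: "\<And>n. \<omega> n \<in> cSigma_space s"
    and mass: "(\<lambda>n. sq_norm lborel (\<omega> n)) \<longlonglongrightarrow> c\<^sup>2"
    and J: "(\<lambda>n. J_fun C s \<sigma> (\<omega> n)) \<longlonglongrightarrow> (INF \<eta>\<in>(mass_sphere s c :: (real^'n \<Rightarrow> complex) set). J_fun C s \<sigma> \<eta>)"
    and bdd: "bdd_below (J_fun C s \<sigma> ` (mass_sphere s c :: (real^'n \<Rightarrow> complex) set))"
  obtains r g where "strict_mono r" "g \<in> ground_states C s \<sigma> c"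
    "(\<lambda>n. cSigma_norm C s (\<lambda>x. \<omega> (r n) x - g x)) \<longlonglongrightarrow> 0"
proof -
  let ?I = "INF \<eta>\<in>(mass_sphere s c :: (real^'n \<Rightarrow> complex) set). J_fun C s \<sigma> \<eta>"
  obtain M0 where M0: "\<And>n. sq_norm lborel (\<omega> n) \<le> M0"
    using convergent_sequence_upper_bound[OF mass] by blast
  define M where "M = M0 + 1"
  have M: "0 < M" "\<And>n. sq_norm lborel (\<omega> n) \<le> M"
    using M0 order_trans[OF sq_norm_nonneg M0] by (auto simp: M_def intro: order_trans[OF M0])
  obtain K where K: "\<And>\<omega> :: real^'n \<Rightarrow> complex. \<omega> \<in> cSigma_space s \<Longrightarrow> sq_norm lborel \<omega> \<le> M \<Longrightarrow>
      (C * gag_sq s \<omega> + weight_sq \<omega>) / 4 \<le> J_fun C s \<sigma> \<omega> + K"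
    using J_fun_coercive[OF s \<sigma> C M(1)] by blast
  obtain J0 where J0: "\<And>n. J_fun C s \<sigma> (\<omega> n) \<le> J0"
    using convergent_sequence_upper_bound[OF J] by blast
  define B0 where "B0 = 4 * (J0 + K)"
  have quad: "C * gag_sq s (\<omega> n) + weight_sq (\<omega> n) \<le> B0" for n
    using K[OF \<omega> M(2), of n] J0[of n] by (simp add: B0_def)
  define B where "B = max M (max (B0 / C) B0)"
  have B: "sq_norm lborel (\<omega> n) \<le> B" "gag_sq s (\<omega> n) \<le> B" "weight_sq (\<omega> n) \<le> B" for n
  proof -
    have "0 \<le> C * gag_sq s (\<omega> n)" "0 \<le> weight_sq (\<omega> n)" using C by auto
    then have "C * gag_sq s (\<omega> n) \<le> B0" "weight_sq (\<omega> n) \<le> B0" using quad[of n] by linarith+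
    moreover have "gag_sq s (\<omega> n) \<le> B0 / C" using calculation(1) C by (simp add: pos_le_divide_eq mult.commute)
    ultimately show "sq_norm lborel (\<omega> n) \<le> B" "gag_sq s (\<omega> n) \<le> B" "weight_sq (\<omega> n) \<le> B"
      using M(2)[of n] by (auto simp: B_def intro: max.coboundedI1 max.coboundedI2)
  qed
  have B_nonneg: "0 \<le> B" using order_trans[OF sq_norm_nonneg B(1)] .
  obtain r g where r: "strict_mono r" and g_L2: "sq_integrable lborel g"
    and AE: "AE x in lborel. (\<lambda>n. \<omega> (r n) x) \<longlonglongrightarrow> g x"
    and L2: "(\<lambda>n. sq_norm lborel (\<lambda>x. \<omega> (r n) x - g x)) \<longlonglongrightarrow> 0"
    by (rule compact_embedding[OF s cSigma_spaceD(1)[OF \<omega>] B(1) cSigma_spaceD(2)[OF \<omega>] B(2) cSigma_spaceD(3)[OF \<omega>] B(3)])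
  have [measurable]: "g \<in> borel_measurable lborel" using g_L2 by (simp add: sq_integrable_def)
  note AE_gag = AE_gag_quotient_tendsto[OF AE, of s]
  have AE_weight: "AE x in lborel. (\<lambda>n. norm x *\<^sub>R \<omega> (r n) x) \<longlonglongrightarrow> norm x *\<^sub>R g x"
    using AE by eventually_elim (intro tendsto_intros)
  have g_gag: "sq_integrable (lborel \<Otimes>\<^sub>M lborel) (gag_quotient s g)"
    by (rule sq_integrable_AE_limit[OF cSigma_spaceD(2)[OF \<omega>] _ AE_gag B_nonneg]) (use B(2) in auto)
  have g_weight: "sq_integrable lborel (\<lambda>x. norm x *\<^sub>R g x)"
    by (rule sq_integrable_AE_limit[OF cSigma_spaceD(3)[OF \<omega>] _ AE_weight B_nonneg]) (use B(3) in auto)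
  have g: "g \<in> cSigma_space s" using g_L2 g_gag g_weight by (simp add: cSigma_space_iff)
  have "(\<lambda>n. sq_norm lborel (\<omega> (r n))) \<longlonglongrightarrow> sq_norm lborel g"
    by (rule sq_norm_tendsto[OF cSigma_spaceD(1)[OF \<omega>] g_L2 L2])
  then have "sq_norm lborel g = c\<^sup>2"
    using LIMSEQ_subseq_LIMSEQ[OF mass r] LIMSEQ_unique by (auto simp: o_def)
  with g have sphere: "g \<in> mass_sphere s c" by (simp add: mass_sphere_iff)
  have pot: "(\<lambda>n. potential \<sigma> (\<omega> (r n))) \<longlonglongrightarrow> potential \<sigma> g"
    by (rule potential_tendsto[OF s \<sigma> \<omega> g B(1) B(2) L2])
  define L where "L = 2 * (?I + 1 / (2 * \<sigma> + 2) * potential \<sigma> g)"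
  have Jr: "(\<lambda>n. J_fun C s \<sigma> (\<omega> (r n))) \<longlonglongrightarrow> ?I"
    using LIMSEQ_subseq_LIMSEQ[OF J r] by (simp add: o_def)
  have "(\<lambda>n. 2 * (J_fun C s \<sigma> (\<omega> (r n)) + 1 / (2 * \<sigma> + 2) * potential \<sigma> (\<omega> (r n)))) \<longlonglongrightarrow> L"
    unfolding L_def by (intro tendsto_intros Jr pot)
  moreover have "2 * (J_fun C s \<sigma> (\<omega> (r n)) + 1 / (2 * \<sigma> + 2) * potential \<sigma> (\<omega> (r n)))
      = C * gag_sq s (\<omega> (r n)) + weight_sq (\<omega> (r n))" for n
    unfolding J_fun_eq[OF \<omega> C] by argo
  ultimately have quad_lim: "(\<lambda>n. C * gag_sq s (\<omega> (r n)) + weight_sq (\<omega> (r n))) \<longlonglongrightarrow> L"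
    by simp
  have "?I \<le> J_fun C s \<sigma> g" by (rule cINF_lower[OF bdd sphere])
  then have L_le: "L \<le> C * gag_sq s g + weight_sq g"
    unfolding J_fun_eq[OF g C] L_def by argo
  have lsc_gag: "\<forall>\<^sub>F n in sequentially. y < C * gag_sq s (\<omega> (r n))" if "y < C * gag_sq s g" for y
  proof -
    have "y / C < gag_sq s g" using that C by (simp add: pos_divide_less_eq mult.commute)
    then have "\<forall>\<^sub>F n in sequentially. y / C < gag_sq s (\<omega> (r n))"
      by (rule sq_norm_lower_semicontinuous[OF cSigma_spaceD(2)[OF \<omega>] g_gag AE_gag])
    then show ?thesis by eventually_elim (use C in \<open>simp add: pos_divide_less_eq mult.commute\<close>)
  qed
  have lsc_weight: "\<forall>\<^sub>F n in sequentially. y < weight_sq (\<omega> (r n))" if "y < weight_sq g" for y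
    by (rule sq_norm_lower_semicontinuous[OF cSigma_spaceD(3)[OF \<omega>] g_weight AE_weight that])
  have gag_lim: "(\<lambda>n. C * gag_sq s (\<omega> (r n))) \<longlonglongrightarrow> C * gag_sq s g"
    by (rule lower_semicontinuous_sum_tendsto[OF quad_lim L_le lsc_gag lsc_weight])
  have weight_lim: "(\<lambda>n. weight_sq (\<omega> (r n))) \<longlonglongrightarrow> weight_sq g"
    using quad_lim L_le
    by (intro lower_semicontinuous_sum_tendsto[OF _ _ lsc_weight lsc_gag, where L=L]) (simp_all add: add.commute)
  have "L = C * gag_sq s g + weight_sq g"
    using LIMSEQ_unique[OF quad_lim tendsto_add[OF gag_lim weight_lim]] .
  then have "J_fun C s \<sigma> g = ?I" unfolding J_fun_eq[OF g C] L_def by argo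
  with sphere have ground: "g \<in> ground_states C s \<sigma> c" by (simp add: ground_states_def)
  have "(\<lambda>n. 1 / C * (C * gag_sq s (\<omega> (r n)))) \<longlonglongrightarrow> 1 / C * (C * gag_sq s g)"
    by (intro tendsto_intros gag_lim)
  then have gag_lim': "(\<lambda>n. gag_sq s (\<omega> (r n))) \<longlonglongrightarrow> gag_sq s g" using C by simp
  have "(\<lambda>n. gag_sq s (\<lambda>x. \<omega> (r n) x - g x)) \<longlonglongrightarrow> 0"
    unfolding gag_quotient_diff by (rule sq_norm_diff_tendsto_0[OF cSigma_spaceD(2)[OF \<omega>] g_gag AE_gag gag_lim'])
  moreover have "(\<lambda>n. weight_sq (\<lambda>x. \<omega> (r n) x - g x)) \<longlonglongrightarrow> 0"
    unfolding scaleR_diff_right by (rule sq_norm_diff_tendsto_0[OF cSigma_spaceD(3)[OF \<omega>] g_weight AE_weight weight_lim])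
  ultimately have "(\<lambda>n. cSigma_norm C s (\<lambda>x. \<omega> (r n) x - g x)) \<longlonglongrightarrow> 0"
    using L2 cSigma_norm_tendsto_0_iff[OF cSigma_space_diff[OF \<omega> g] C] by blast
  from that[OF r ground this] show ?thesis .
qed

section \<open>Orbital stability\<close>

lemma bdd_below_J_fun_mass_sphere:
  assumes s: "0 < s" and \<sigma>: "0 < \<sigma>" "\<sigma> < 2 * s / real CARD('n)" and C: "0 < C" and c: "0 < c"
  shows "bdd_below (J_fun C s \<sigma> ` (mass_sphere s c :: (real^'n \<Rightarrow> complex) set))"
proof -
  obtain K where K: "\<And>\<omega> :: real^'n \<Rightarrow> complex. \<omega> \<in> cSigma_space s \<Longrightarrow> sq_norm lborel \<omega> \<le> c\<^sup>2 \<Longrightarrow>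
      (C * gag_sq s \<omega> + weight_sq \<omega>) / 4 \<le> J_fun C s \<sigma> \<omega> + K"
    using J_fun_coercive[OF s \<sigma> C, of "c\<^sup>2"] c by auto
  have "- K \<le> J_fun C s \<sigma> \<omega>" if "\<omega> \<in> mass_sphere s c" for \<omega> :: "real^'n \<Rightarrow> complex"
  proof -
    have "0 \<le> C * gag_sq s \<omega> + weight_sq \<omega>" using C by (intro add_nonneg_nonneg mult_nonneg_nonneg) auto
    then show ?thesis using K[of \<omega>] that by (simp add: mass_sphere_iff)
  qed
  then show ?thesis by (intro bdd_belowI2)
qed

lemma ground_states_nonempty:
  assumes s: "0 < s" "s < 1" and \<sigma>: "0 < \<sigma>" "\<sigma> < 2 * s / real CARD('n)" and C: "0 < C" and c: "0 < c"
  shows "(ground_states C s \<sigma> c :: (real^'n \<Rightarrow> complex) set) \<noteq> {}"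
proof -
  let ?S = "mass_sphere s c :: (real^'n \<Rightarrow> complex) set"
  let ?I = "INF \<eta>\<in>?S. J_fun C s \<sigma> \<eta>"
  note bdd = bdd_below_J_fun_mass_sphere[OF s(1) \<sigma> C c]
  have "\<exists>\<omega>\<in>?S. J_fun C s \<sigma> \<omega> < ?I + 1 / real (Suc n)" for n
  proof -
    have "?I < ?I + 1 / real (Suc n)" by simp
    then show ?thesis using cINF_less_iff[OF mass_sphere_nonempty[OF s] bdd] by blast
  qed
  then obtain \<omega> where \<omega>: "\<And>n. \<omega> n \<in> ?S" "\<And>n. J_fun C s \<sigma> (\<omega> n) < ?I + 1 / real (Suc n)" by metis
  have "(\<lambda>n. ?I + 1 / real (Suc n)) \<longlonglongrightarrow> ?I + 0"
    by (intro tendsto_intros LIMSEQ_Suc[OF lim_1_over_n])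
  then have upper: "(\<lambda>n. ?I + 1 / real (Suc n)) \<longlonglongrightarrow> ?I" by simp
  have "(\<lambda>n. J_fun C s \<sigma> (\<omega> n)) \<longlonglongrightarrow> ?I"
    by (rule tendsto_sandwich[OF eventuallyI eventuallyI tendsto_const upper])
      (use cINF_lower[OF bdd \<omega>(1)] less_imp_le[OF \<omega>(2)] in simp_all)
  note J = this
  have "\<omega> n \<in> cSigma_space s" "sq_norm lborel (\<omega> n) = c\<^sup>2" for n
    using \<omega>(1)[of n] by (auto simp: mass_sphere_iff)
  note space = this(1) and mass = this(2)
  have mass_lim: "(\<lambda>n. sq_norm lborel (\<omega> n)) \<longlonglongrightarrow> c\<^sup>2" unfolding mass by (rule tendsto_const)
  obtain g :: "real^'n \<Rightarrow> complex" where "g \<in> ground_states C s \<sigma> c"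
    by (rule minimizing_sequence_precompact[OF s(1) \<sigma> C space mass_lim J bdd])
  then show ?thesis by blast
qed

text \<open>
  Initial data approaching a ground state have masses tending to \<open>c\<^sup>2\<close> and energies tending to the
  minimum. Conservation transports both limits to arbitrary later times, so the solutions at
  those times form a minimizing sequence, and a subsequence of it must approach the ground states.
\<close>

theorem theorem2p2:
  fixes s \<sigma> c C :: real
  assumes s: "0 < s" "s < 1"
    and \<sigma>: "0 < \<sigma>" "\<sigma> < 2 * s / real CARD('n::finite)"
    and c: "c > 0"
    and C: "normalization_constant TYPE('n) s C"
    and existence: "\<And>\<psi>0 :: real ^ 'n \<Rightarrow> complex. \<psi>0 \<in> cSigma_space s \<Longrightarrow> \<exists>\<psi>. NLS_solution C s \<sigma> \<psi>0 \<psi>"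
    and uniqueness: "\<And>(\<psi>0 :: real ^ 'n \<Rightarrow> complex) \<psi> \<psi>' t.
      \<psi>0 \<in> cSigma_space s \<Longrightarrow> NLS_solution C s \<sigma> \<psi>0 \<psi> \<Longrightarrow> NLS_solution C s \<sigma> \<psi>0 \<psi>' \<Longrightarrow> t \<ge> 0 \<Longrightarrow>
        AE x in lborel. \<psi> t x = \<psi>' t x"
    and mass_conservation: "\<And>(\<psi>0 :: real ^ 'n \<Rightarrow> complex) \<psi> t.
      \<psi>0 \<in> cSigma_space s \<Longrightarrow> NLS_solution C s \<sigma> \<psi>0 \<psi> \<Longrightarrow> t \<ge> 0 \<Longrightarrow> L2_norm (\<psi> t) = L2_norm \<psi>0"
    and energy_conservation: "\<And>(\<psi>0 :: real ^ 'n \<Rightarrow> complex) \<psi> t.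
      \<psi>0 \<in> cSigma_space s \<Longrightarrow> NLS_solution C s \<sigma> \<psi>0 \<psi> \<Longrightarrow> t \<ge> 0 \<Longrightarrow> energy C s \<sigma> (\<psi> t) = energy C s \<sigma> \<psi>0"
  shows "orbitally_stable C s \<sigma> (ground_states C s \<sigma> c :: (real ^ 'n \<Rightarrow> complex) set)"
proof -
  let ?G = "ground_states C s \<sigma> c :: (real ^ 'n \<Rightarrow> complex) set"
  have C0: "0 < C" using C by (simp add: normalization_constant_def)
  note bdd = bdd_below_J_fun_mass_sphere[OF s(1) \<sigma> C0 c]
  have stable: "\<exists>\<delta>>0. \<forall>\<psi>0\<in>cSigma_space s. cSigma_norm C s (\<lambda>x. \<omega>0 x - \<psi>0 x) < \<delta> \<longrightarrow>
        (\<forall>\<psi>. NLS_solution C s \<sigma> \<psi>0 \<psi> \<longrightarrow>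
           (\<forall>t\<ge>0. (INF \<omega>\<in>?G. cSigma_norm C s (\<lambda>x. \<omega> x - \<psi> t x)) < \<epsilon>))"
    if \<omega>0: "\<omega>0 \<in> ?G" and \<epsilon>: "0 < \<epsilon>" for \<omega>0 \<epsilon>
  proof (rule ccontr)
    assume "\<not> ?thesis"
    then have bad: "\<exists>\<psi>0\<in>cSigma_space s. cSigma_norm C s (\<lambda>x. \<omega>0 x - \<psi>0 x) < 1 / real (Suc n) \<and>
        (\<exists>\<psi> t. NLS_solution C s \<sigma> \<psi>0 \<psi> \<and> 0 \<le> t \<and> \<not> (INF \<omega>\<in>?G. cSigma_norm C s (\<lambda>x. \<omega> x - \<psi> t x)) < \<epsilon>)" for n
      by (meson of_nat_0_less_iff zero_less_Suc zero_less_divide_1_iff)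
    define near where "near n \<psi>0 \<longleftrightarrow> cSigma_norm C s (\<lambda>x. \<omega>0 x - \<psi>0 x) < 1 / real (Suc n)" for n \<psi>0
    define far where "far \<phi> \<longleftrightarrow> \<not> (INF \<omega>\<in>?G. cSigma_norm C s (\<lambda>x. \<omega> x - \<phi> x)) < \<epsilon>" for \<phi> :: "real ^ 'n \<Rightarrow> complex"
    have "\<exists>\<psi>0 \<psi> t. \<psi>0 \<in> cSigma_space s \<and> near n \<psi>0 \<and> NLS_solution C s \<sigma> \<psi>0 \<psi> \<and> 0 \<le> t \<and> far (\<psi> t)" for n
      using bad[of n] unfolding near_def[symmetric] far_def[symmetric] by blast
    then obtain \<psi>0 \<psi> t where \<psi>0: "\<And>n. \<psi>0 n \<in> cSigma_space s" and close: "\<And>n. near n (\<psi>0 n)"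
      and sol: "\<And>n. NLS_solution C s \<sigma> (\<psi>0 n) (\<psi> n)" and t: "\<And>n. 0 \<le> t n" and far: "\<And>n. far (\<psi> n (t n))"
      by metis
    define w where "w n = \<psi> n (t n)" for n
    have w: "w n \<in> cSigma_space s" for n using sol[of n] t[of n] by (simp add: NLS_solution_def w_def)
    have \<omega>0': "\<omega>0 \<in> cSigma_space s" "sq_norm lborel \<omega>0 = c\<^sup>2"
      "J_fun C s \<sigma> \<omega>0 = (INF \<eta>\<in>(mass_sphere s c :: (real ^ 'n \<Rightarrow> complex) set). J_fun C s \<sigma> \<eta>)"
      using \<omega>0 by (auto simp: ground_states_def mass_sphere_iff)
    have "cSigma_norm C s (\<lambda>x. \<psi>0 n x - \<omega>0 x) \<le> 1 / real (Suc n)" for n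
      unfolding cSigma_norm_minus_commute[of C s "\<psi>0 n"] by (rule less_imp_le[OF close[unfolded near_def]])
    then have "(\<lambda>n. cSigma_norm C s (\<lambda>x. \<psi>0 n x - \<omega>0 x)) \<longlonglongrightarrow> 0"
      by (intro tendsto_sandwich[OF eventuallyI eventuallyI tendsto_const LIMSEQ_Suc[OF lim_1_over_n]] cSigma_norm_nonneg)
    note data = mass_continuous[OF s(1) \<sigma> C0 \<psi>0 \<omega>0'(1) this] J_fun_continuous[OF s(1) \<sigma> C0 \<psi>0 \<omega>0'(1) this]
    have "sq_norm lborel (w n) = sq_norm lborel (\<psi>0 n)" for n
      using mass_conservation[OF \<psi>0 sol t, of n] by (simp add: L2_norm_eq w_def)
    then have mass: "(\<lambda>n. sq_norm lborel (w n)) \<longlonglongrightarrow> c\<^sup>2" using data(1) \<omega>0'(2) by simp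
    have "J_fun C s \<sigma> (w n) = J_fun C s \<sigma> (\<psi>0 n)" for n
      using energy_conservation[OF \<psi>0 sol t, of n]
        energy_eq_twice_J_fun[OF s(1) \<sigma> w C0, of n] energy_eq_twice_J_fun[OF s(1) \<sigma> \<psi>0 C0, of n]
      by (simp add: w_def)
    then have J: "(\<lambda>n. J_fun C s \<sigma> (w n)) \<longlonglongrightarrow> (INF \<eta>\<in>(mass_sphere s c :: (real ^ 'n \<Rightarrow> complex) set). J_fun C s \<sigma> \<eta>)"
      using data(2) \<omega>0'(3) by simp
    obtain r g where g: "g \<in> ?G" and lim: "(\<lambda>n. cSigma_norm C s (\<lambda>x. w (r n) x - g x)) \<longlonglongrightarrow> 0"
      by (rule minimizing_sequence_precompact[OF s(1) \<sigma> C0 w mass J bdd])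
    obtain n where n: "cSigma_norm C s (\<lambda>x. w (r n) x - g x) < \<epsilon>"
      using order_tendstoD(2)[OF lim \<epsilon>] by (auto simp: eventually_sequentially)
    have "(INF \<omega>\<in>?G. cSigma_norm C s (\<lambda>x. \<omega> x - w (r n) x)) \<le> cSigma_norm C s (\<lambda>x. g x - w (r n) x)"
      by (intro cINF_lower g bdd_belowI2[where m=0] cSigma_norm_nonneg)
    also have "\<dots> < \<epsilon>" using n by (simp add: cSigma_norm_minus_commute[of C s g])
    finally show False using far[of "r n"] by (simp add: w_def far_def)
  qed
  then show ?thesis
    unfolding orbitally_stable_def using ground_states_nonempty[OF s \<sigma> C0 c] by blast
qed

end
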